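(* There exists a universal constant $C>0$ such that the following is true. Let $d\in\{2,3\}$, $\Omega=\mathbb T^{d-1}\times(0,1)$ and $A>0$. Consider any family $u^\nu$ of Leray–Hopf solutions to the Navier–Stokes equation $(\mathrm{NSE}_\nu)$ in $\Omega$ such that the initial values $u^\nu_0=u^\nu(0)$ converge strongly in $L^2(\Omega)$ to $Ae_1$ as $\nu\to0$. Then, for any weak limit $u^\infty$ of weakly convergent subsequences of $u^\nu$ (as $\nu\to0$), we have for almost every $T>0$ that $$\|u^\infty(T)-Ae_1\|_{L^2(\Omega)}^2\le CA^3T.$$
   Context: $\mathbb T=[0,1]_{\mathrm{per}}$ and $e_1$ is the first coordinate vector. $(\mathrm{NSE}_\nu)$, with viscosity $\nu>0$, is $$\partial_t u^\nu+u^\nu\cdot\nabla u^\nu+\nabla P^\nu=\nu\Delta u^\nu,\qquad\operatorname{div}u^\nu=0\quad\text{in }(0,T)\times\Omega,\qquad u^\nu=0\ \text{for }x_d=0\text{ and }x_d=1.$$ A Leray–Hopf solution is a weak solution to $(\mathrm{NSE}_\nu)$ which in addition verifies the energy inequality $\frac12\frac{d}{dt}\|u^\nu\|_{L^2(\Omega)}^2\le-\nu\|\nabla u^\nu\|_{L^2(\Omega)}^2$. The solutions $u^\nu$ are uniformly bounded in $L^\infty(\mathbb R^+;L^2(\Omega))$, hence converge weakly up to a subsequence in $L^2_{t,x}$ (on bounded time intervals); weak limits are understood in this sense. *)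

theory Defs
  imports "HOL-Analysis.Analysis"
begin

section \<open>Smooth functions\<close>

primrec Ck :: "nat \<Rightarrow> ('a::euclidean_space \<Rightarrow> 'b::real_normed_vector) \<Rightarrow> bool" where
  "Ck 0 f \<longleftrightarrow> continuous_on UNIV f"
| "Ck (Suc k) f \<longleftrightarrow>
     (\<forall>x. f differentiable (at x)) \<and> (\<forall>b\<in>Basis. Ck k (\<lambda>x. frechet_derivative f (at x) b))"

definition smooth :: "('a::euclidean_space \<Rightarrow> 'b::real_normed_vector) \<Rightarrow> bool" where
  "smooth f \<longleftrightarrow> (\<forall>k. Ck k f)"

section \<open>The periodic channel\<close>

text \<open>
  The channel is the product of the (d-1)-dimensional torus and the interval (0,1). The vertical
  coordinate, called \<open>x\<^sub>d\<close> in the mathematics, is the coordinate \<open>x $ v\<close> whose index \<open>v\<close> is a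
  parameter throughout; the coordinates with index different from \<open>v\<close> are periodic.

  A Lebesgue class of functions on the channel is the same thing as a Lebesgue class of functions
  on the fundamental cell \<open>cell\<close>, so fields are only ever evaluated on \<open>cell\<close>. The periodicity
  enters through the test functions: these are smooth functions on the whole space which are
  1-periodic in the horizontal coordinates, and need not vanish on the lateral faces of
  \<open>cell\<close>. Hence weak derivatives and weak equations are those on the torus, without
  contributions from the lateral faces.
\<close>

definition cell :: "(real^'n) set" where
  "cell = {x. \<forall>i. 0 < x $ i \<and> x $ i < 1}"

definition horizontally_periodic :: "'n::finite \<Rightarrow> (real^'n \<Rightarrow> 'b) \<Rightarrow> bool" where
  "horizontally_periodic v f \<longleftrightarrow> (\<forall>i x. i \<noteq> v \<longrightarrow> f (x + axis i 1) = f x)"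

text \<open>Smooth functions with compact support in the channel, extended by zero in the vertical
  direction.\<close>

definition space_test :: "'n::finite \<Rightarrow> (real^'n \<Rightarrow> 'b::real_normed_vector) \<Rightarrow> bool" where
  "space_test v \<psi> \<longleftrightarrow> smooth \<psi> \<and> horizontally_periodic v \<psi> \<and>
     (\<exists>\<delta>>0. \<forall>x. \<psi> x \<noteq> 0 \<longrightarrow> \<delta> \<le> x $ v \<and> x $ v \<le> 1 - \<delta>)"

text \<open>Smooth functions with compact support in the product of \<open>(0,\<infinity>)\<close> and the channel.\<close>

definition spacetime_test :: "'n::finite \<Rightarrow> (real \<times> (real^'n) \<Rightarrow> 'b::real_normed_vector) \<Rightarrow> bool" where
  "spacetime_test v \<phi> \<longleftrightarrow> smooth \<phi> \<and> (\<forall>t. horizontally_periodic v (\<lambda>x. \<phi> (t, x))) \<and>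
     (\<exists>a>0. \<exists>b. \<exists>\<delta>>0. \<forall>t x. \<phi> (t, x) \<noteq> 0 \<longrightarrow>
        a \<le> t \<and> t \<le> b \<and> \<delta> \<le> x $ v \<and> x $ v \<le> 1 - \<delta>)"

section \<open>Square-integrable functions\<close>

text \<open>The square of the \<open>L\<^sup>2\<close> norm, with value \<open>\<infinity>\<close> if the integral diverges.\<close>

definition L2sq :: "'a::euclidean_space set \<Rightarrow> ('a \<Rightarrow> 'b::euclidean_space) \<Rightarrow> ennreal" where
  "L2sq S f = (\<integral>\<^sup>+ x. ennreal ((norm (f x))\<^sup>2) \<partial>lebesgue_on S)"

definition in_L2 :: "'a::euclidean_space set \<Rightarrow> ('a \<Rightarrow> 'b::euclidean_space) \<Rightarrow> bool" where
  "in_L2 S f \<longleftrightarrow> f \<in> borel_measurable (lebesgue_on S) \<and> L2sq S f < \<infinity>"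

definition L2_inner :: "'a::euclidean_space set \<Rightarrow> ('a \<Rightarrow> 'b::euclidean_space) \<Rightarrow> ('a \<Rightarrow> 'b) \<Rightarrow> real" where
  "L2_inner S f g = (\<integral>x. f x \<bullet> g x \<partial>lebesgue_on S)"

definition L2_weakly_converges ::
    "'a::euclidean_space set \<Rightarrow> (nat \<Rightarrow> 'a \<Rightarrow> 'b::euclidean_space) \<Rightarrow> ('a \<Rightarrow> 'b) \<Rightarrow> bool" where
  "L2_weakly_converges S f g \<longleftrightarrow> (\<forall>k. in_L2 S (f k)) \<and> in_L2 S g \<and>
     (\<forall>w. in_L2 S w \<longrightarrow> (\<lambda>k. L2_inner S (f k) w) \<longlonglongrightarrow> L2_inner S g w)"

section \<open>Sobolev fields vanishing on the walls\<close>

text \<open>\<open>weak_gradient v w G\<close>: the matrix field with entries \<open>G $ i $ j\<close> is the distributional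
  gradient, with \<open>G $ i $ j\<close> the j-th partial derivative of the i-th component of \<open>w\<close>. This is the
  index convention of \<^const>\<open>jacobian\<close>.\<close>

definition weak_gradient ::
    "'n::finite \<Rightarrow> (real^'n \<Rightarrow> real^'n) \<Rightarrow> (real^'n \<Rightarrow> real^'n^'n) \<Rightarrow> bool" where
  "weak_gradient v w G \<longleftrightarrow> (\<forall>\<psi> :: real^'n \<Rightarrow> real. space_test v \<psi> \<longrightarrow> (\<forall>i j.
     (\<integral>x. w x $ i * frechet_derivative \<psi> (at x) (axis j 1) \<partial>lebesgue_on cell) =
     - (\<integral>x. G x $ i $ j * \<psi> x \<partial>lebesgue_on cell)))"

text \<open>\<open>H10 v w G\<close>: \<open>w\<close> belongs to \<open>H\<^sup>1\<^sub>0\<close> of the channel, the closure of the compactly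
  supported smooth fields in the \<open>H\<^sup>1\<close> norm, and \<open>G\<close> is its gradient. This expresses the no-slip
  condition at \<open>x $ v = 0\<close> and \<open>x $ v = 1\<close>.\<close>

definition H10 ::
    "'n::finite \<Rightarrow> (real^'n \<Rightarrow> real^'n) \<Rightarrow> (real^'n \<Rightarrow> real^'n^'n) \<Rightarrow> bool" where
  "H10 v w G \<longleftrightarrow> in_L2 cell w \<and> in_L2 cell G \<and> weak_gradient v w G \<and>
     (\<exists>\<phi>. (\<forall>k::nat. space_test v (\<phi> k)) \<and>
        (\<lambda>k. L2sq cell (\<lambda>x. \<phi> k x - w x)) \<longlonglongrightarrow> 0 \<and>
        (\<lambda>k. L2sq cell (\<lambda>x. jacobian (\<phi> k) (at x) - G x)) \<longlonglongrightarrow> 0)"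

section \<open>Leray--Hopf solutions\<close>

text \<open>\<open>u t x\<close> is the velocity and \<open>G t x\<close> its spatial gradient. The velocity is the representative
  which is weakly continuous in time with values in \<open>L\<^sup>2\<close>, up to and including time 0, so that
  \<open>u t\<close> is meaningful for every \<open>t \<ge> 0\<close> and \<open>u 0\<close> is the initial value.\<close>

definition energy_class ::
    "'n::finite \<Rightarrow> (real \<Rightarrow> real^'n \<Rightarrow> real^'n) \<Rightarrow> (real \<Rightarrow> real^'n \<Rightarrow> real^'n^'n) \<Rightarrow> bool" where
  "energy_class v u G \<longleftrightarrow>
     (\<forall>t\<ge>0. in_L2 cell (u t)) \<and>
     (\<forall>w. in_L2 cell w \<longrightarrow> continuous_on {0..} (\<lambda>t. L2_inner cell (u t) w)) \<and>
     (\<forall>T>0. in_L2 ({0<..<T} \<times> cell) (\<lambda>(t, x). u t x)) \<and>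
     (\<forall>T>0. \<exists>M::real. AE t in lebesgue. 0 < t \<and> t < T \<longrightarrow> L2sq cell (u t) \<le> ennreal M) \<and>
     (\<forall>T>0. in_L2 ({0<..<T} \<times> cell) (\<lambda>(t, x). G t x)) \<and>
     (AE t in lebesgue. 0 < t \<longrightarrow> H10 v (u t) (G t))"

text \<open>Weak form of the Navier--Stokes equations with viscosity \<open>\<nu>\<close> on all positive times. The
  pressure is eliminated by testing with divergence-free fields; \<open>(jacobian \<phi> *v u) \<bullet> u\<close> is the
  contraction of the tensor square of \<open>u\<close> with the gradient of \<open>\<phi>\<close>, and the inner product of
  matrices is the Frobenius one.\<close>

definition weak_NSE ::
    "'n::finite \<Rightarrow> real \<Rightarrow> (real \<Rightarrow> real^'n \<Rightarrow> real^'n) \<Rightarrow> (real \<Rightarrow> real^'n \<Rightarrow> real^'n^'n) \<Rightarrow> bool" where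
  "weak_NSE v \<nu> u G \<longleftrightarrow>
     (AE (t, x) in lebesgue_on ({0<..} \<times> cell). trace (G t x) = 0) \<and>
     (\<forall>\<phi> :: real \<times> (real^'n) \<Rightarrow> real^'n.
        spacetime_test v \<phi> \<and> (\<forall>t x. trace (jacobian (\<lambda>y. \<phi> (t, y)) (at x)) = 0) \<longrightarrow>
        (\<integral>(t, x). u t x \<bullet> vector_derivative (\<lambda>s. \<phi> (s, x)) (at t)
            + (jacobian (\<lambda>y. \<phi> (t, y)) (at x) *v u t x) \<bullet> u t x
            - \<nu> * (G t x \<bullet> jacobian (\<lambda>y. \<phi> (t, y)) (at x))
          \<partial>lebesgue_on ({0<..} \<times> cell)) = 0)"

text \<open>The differential inequality
  \<open>(1/2) d/dt \<parallel>u\<parallel>\<^sup>2 \<le> - \<nu> \<parallel>\<nabla>u\<parallel>\<^sup>2\<close> in the sense of distributions on \<open>[0,\<infinity>)\<close>, that is, including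
  the initial time: the test functions need not vanish at 0.\<close>

definition energy_inequality ::
    "real \<Rightarrow> (real \<Rightarrow> real^'n::finite \<Rightarrow> real^'n) \<Rightarrow> (real \<Rightarrow> real^'n \<Rightarrow> real^'n^'n) \<Rightarrow> bool" where
  "energy_inequality \<nu> u G \<longleftrightarrow>
     (\<forall>\<eta> :: real \<Rightarrow> real.
        smooth \<eta> \<and> (\<forall>t. 0 \<le> \<eta> t) \<and> (\<exists>R. \<forall>t. \<eta> t \<noteq> 0 \<longrightarrow> \<bar>t\<bar> \<le> R) \<longrightarrow>
        - (\<integral>t. deriv \<eta> t * (enn2real (L2sq cell (u t)) / 2) \<partial>lebesgue_on {0<..})
          - \<eta> 0 * (enn2real (L2sq cell (u 0)) / 2)
        \<le> - \<nu> * (\<integral>t. \<eta> t * enn2real (L2sq cell (G t)) \<partial>lebesgue_on {0<..}))"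

definition leray_hopf :: "'n::finite \<Rightarrow> real \<Rightarrow> (real \<Rightarrow> real^'n \<Rightarrow> real^'n) \<Rightarrow> bool" where
  "leray_hopf v \<nu> u \<longleftrightarrow>
     (\<exists>G. energy_class v u G \<and> weak_NSE v \<nu> u G \<and> energy_inequality \<nu> u G)"

section \<open>The inviscid limit\<close>

text \<open>\<open>u \<nu>\<close> is a family of fields indexed by the viscosity. A weak limit is taken along a sequence
  of viscosities tending to 0, weakly in \<open>L\<^sup>2\<close> on every bounded time interval.\<close>

definition inviscid_weak_limit ::
    "(real \<Rightarrow> real \<Rightarrow> real^'n::finite \<Rightarrow> real^'n) \<Rightarrow> (real \<Rightarrow> real^'n \<Rightarrow> real^'n) \<Rightarrow> bool" where
  "inviscid_weak_limit u U \<longleftrightarrow>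
     (\<exists>\<nu>s :: nat \<Rightarrow> real. (\<forall>k. 0 < \<nu>s k) \<and> \<nu>s \<longlonglongrightarrow> 0 \<and>
        (\<forall>T>0. L2_weakly_converges ({0<..<T} \<times> cell)
                 (\<lambda>k (t, x). u (\<nu>s k) t x) (\<lambda>(t, x). U t x)))"

end

theory Submission
  imports Defs
begin

text \<open>
  Since \<open>A e\<^sub>1\<close> is a constant shear flow, \<open>\<parallel>u - A e\<^sub>1\<parallel>\<^sup>2 / 2\<close> can grow only through the friction at the
  walls. Testing the equation with \<open>f(x\<^sub>d) e\<^sub>1\<close>, where the cutoff \<open>f\<close> equals 1 outside layers of width
  comparable to \<open>\<delta>\<close> along the walls, turns the friction into
  \<open>\<integral> f' (u\<^sub>d u\<^sub>1 - \<nu> \<partial>\<^sub>d u\<^sub>1)\<close> with \<open>\<bar>f'\<bar> \<lesssim> 1 / \<delta>\<close>. The no-slip condition gives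
  \<open>\<integral> \<bar>u\<bar>\<^sup>2 \<lesssim> \<delta>\<^sup>2 \<integral> \<bar>\<nabla>u\<bar>\<^sup>2\<close> over the layers, so for \<open>\<delta> = c \<nu> / A\<close> the convective part is absorbed by the
  dissipation in the energy inequality, and the viscous part costs \<open>A\<^sup>2 \<nu> / \<delta> \<approx> A\<^sup>3\<close> per unit of time.
  As \<open>\<nu> \<rightarrow> 0\<close> the layers shrink and their remaining contribution vanishes. This argument is
  insensitive to the dimension and needs no estimate of the boundary vorticity.
\<close>

section \<open>Calculus of smooth functions\<close>

text \<open>Weakness of the solution concept shapes the argument. \<open>A e_1\<close> does not
  vanish at the walls and is no admissible test field, hence the cutoff. Test fields for the
  momentum must also vanish near time 0, while the energy inequality sees time 0, so the two
  balances are tested with different functions of time and the initial momentum is recovered by weak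
  continuity. The energy need not be continuous in time. The weak limit is one in space-time,
  without information at a fixed time, so the final bound is localised to sets of times. The
  constant: with \<open>B\<close> a bound for the slope of the cutoff profile, \<open>exp 2\<close>
  the price of replacing the layer by an exponential weight, and 16 A B exp(2) \<delta> = \<nu>,
  convection uses one half of the dissipation and Young's inequality for the viscous term the other
  half. What remains is 8 \<nu> A^2 B^2 / \<delta> = 128 B^3 exp(2) A^3 for half the squared
  distance.\<close>

lemma Ck_Suc_imp_Ck: "Ck (Suc k) f \<Longrightarrow> Ck k f"
proof (induction k arbitrary: f)
  case 0
  then show ?case
    by (auto intro: differentiable_imp_continuous_on simp: differentiable_on_def
        intro!: differentiable_at_imp_differentiable_on)
next
  case (Suc k)
  then show ?case by (metis Ck.simps(2))
qed

lemma Ck_Suc_I: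
  assumes "\<And>x. (f has_derivative f' x) (at x)" "\<And>b. b \<in> Basis \<Longrightarrow> Ck k (\<lambda>x. f' x b)"
  shows "Ck (Suc k) f"
proof -
  have "frechet_derivative f (at x) = f' x" for x
    using frechet_derivative_at[OF assms(1)] by simp
  then show ?thesis
    using assms by (auto simp: differentiable_def)
qed

lemma Ck_const: "Ck k (\<lambda>x. c)"
proof (induction k arbitrary: c)
  case (Suc k)
  have "\<And>x. ((\<lambda>x. c) has_derivative (\<lambda>_. 0)) (at x)" by simp
  then show ?case
    using Suc by (rule Ck_Suc_I)
qed simp

lemma Ck_add: "Ck k f \<Longrightarrow> Ck k g \<Longrightarrow> Ck k (\<lambda>x. f x + g x)"
proof (induction k arbitrary: f g)
  case 0 then show ?case by (simp add: continuous_on_add)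
next
  case (Suc k)
  have "((\<lambda>x. f x + g x) has_derivative
      (\<lambda>h. frechet_derivative f (at x) h + frechet_derivative g (at x) h)) (at x)" for x
    using Suc.prems by (intro has_derivative_add) (auto simp: frechet_derivative_works)
  then show ?case
    by (rule Ck_Suc_I) (use Suc in auto)
qed

lemma Ck_bounded_linear:
  assumes "bounded_linear L"
  shows "Ck k f \<Longrightarrow> Ck k (\<lambda>x. L (f x))"
proof (induction k arbitrary: f)
  case 0 then show ?case
    using assms by (simp add: bounded_linear.continuous_on)
next
  case (Suc k)
  have "((\<lambda>x. L (f x)) has_derivative (\<lambda>h. L (frechet_derivative f (at x) h))) (at x)" for x
    using Suc.prems by (intro bounded_linear.has_derivative[OF assms])
      (auto simp: frechet_derivative_works)
  then show ?case
    by (rule Ck_Suc_I) (use Suc in auto)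
qed

lemma Ck_scaleR: "Ck k f \<Longrightarrow> Ck k g \<Longrightarrow> Ck k (\<lambda>x. f x *\<^sub>R g x)"
proof (induction k arbitrary: f g)
  case 0 then show ?case by (simp add: continuous_on_scaleR)
next
  case (Suc k)
  have "((\<lambda>x. f x *\<^sub>R g x) has_derivative
      (\<lambda>h. f x *\<^sub>R frechet_derivative g (at x) h + frechet_derivative f (at x) h *\<^sub>R g x)) (at x)" for x
    using Suc.prems by (intro has_derivative_scaleR) (auto simp: frechet_derivative_works)
  then show ?case
    by (rule Ck_Suc_I) (use Suc.prems Suc.IH Ck_Suc_imp_Ck[OF Suc.prems(1)]
        Ck_Suc_imp_Ck[OF Suc.prems(2)] in \<open>auto intro!: Ck_add\<close>)
qed

lemmas Ck_mult = Ck_scaleR[where ?'b = real, unfolded real_scaleR_def]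

lemma Ck_compose_affine:
  fixes f :: "real \<Rightarrow> 'b::real_normed_vector" and L :: "'a::euclidean_space \<Rightarrow> real"
  assumes "bounded_linear L"
  shows "Ck k f \<Longrightarrow> Ck k (\<lambda>x. f (L x + c))"
proof (induction k arbitrary: f)
  case 0
  have "continuous_on UNIV (\<lambda>x. L x + c)"
    by (intro continuous_intros bounded_linear.continuous_on[OF assms])
  with 0 show ?case
    by (auto intro: continuous_on_compose2)
next
  case (Suc k)
  have 1: "((\<lambda>x. f (L x + c)) has_derivative (\<lambda>h. frechet_derivative f (at (L x + c)) (L h))) (at x)" for x
  proof -
    have "(L has_derivative L) (at x)"
      using assms by (rule bounded_linear_imp_has_derivative)
    then have "((\<lambda>x. L x + c) has_derivative L) (at x)"
      by (auto intro!: derivative_eq_intros)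
    moreover have "(f has_derivative frechet_derivative f (at (L x + c))) (at (L x + c))"
      using Suc.prems by (auto simp: frechet_derivative_works)
    ultimately show ?thesis
      by (rule has_derivative_compose)
  qed
  \<comment> \<open>The induction hypothesis speaks only of the derivative of \<open>f\<close> along
    the basis vector 1, so the direction \<open>L b\<close> is first pulled out as a scalar.\<close>
  have 2: "frechet_derivative f (at y) (L b) = L b *\<^sub>R frechet_derivative f (at y) 1" for y b
    using linear_frechet_derivative[of f "at y"] Suc.prems
    by (metis Ck.simps(2) linear_cmul mult.right_neutral real_scaleR_def)
  show ?case
    by (rule Ck_Suc_I[OF 1]) (unfold 2, use Suc in \<open>auto intro!: Ck_scaleR Ck_const\<close>)
qed

text \<open>The derivative is a product whose only factors are the inverse itself and the derivative
  of \<open>g\<close>; both are covered one order lower, so the induction closes.\<close>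

lemma Ck_inverse:
  fixes g :: "'a::euclidean_space \<Rightarrow> real"
  assumes "\<And>x. g x \<noteq> 0"
  shows "Ck k g \<Longrightarrow> Ck k (\<lambda>x. inverse (g x))"
proof (induction k)
  case 0 then show ?case
    using assms by (auto intro!: continuous_on_inverse)
next
  case (Suc k)
  have "((\<lambda>x. inverse (g x)) has_derivative
      (\<lambda>h. - (inverse (g x) * frechet_derivative g (at x) h * inverse (g x)))) (at x)" for x
    using Suc.prems assms by (intro Deriv.has_derivative_inverse) (auto simp: frechet_derivative_works)
  then show ?case
  proof (rule Ck_Suc_I)
    fix b :: 'a assume "b \<in> Basis"
    then have "Ck k (\<lambda>x. frechet_derivative g (at x) b)"
      using Suc.prems by simp
    then show "Ck k (\<lambda>x. - (inverse (g x) * frechet_derivative g (at x) b * inverse (g x)))"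
      using Suc.IH[OF Ck_Suc_imp_Ck[OF Suc.prems]]
      by (intro Ck_bounded_linear[OF bounded_linear_minus[OF bounded_linear_ident]] Ck_mult)
  qed
qed

lemma Ck_real_Suc_I:
  fixes f f' :: "real \<Rightarrow> real"
  assumes "\<And>x. (f has_real_derivative f' x) (at x)" "Ck k f'"
  shows "Ck (Suc k) f"
proof (rule Ck_Suc_I)
  show "(f has_derivative (\<lambda>h. h *\<^sub>R f' x)) (at x)" for x
    using assms(1)[of x] unfolding has_field_derivative_def
    by (simp add: mult.commute[of _ "f' x"])
qed (use assms(2) in auto)

lemma Ck_exp: "Ck k (exp :: real \<Rightarrow> real)"
proof (induction k)
  case (Suc k)
  show ?case by (rule Ck_real_Suc_I[OF DERIV_exp Suc])
qed (simp add: continuous_on_exp)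

lemma frechet_derivative_real:
  fixes f :: "real \<Rightarrow> real"
  assumes "(f has_real_derivative D) (at x)"
  shows "frechet_derivative f (at x) h = D * h"
  using assms frechet_derivative_at[of f "(*) D" x] unfolding has_field_derivative_def by metis

lemma smooth_has_real_derivative:
  fixes f :: "real \<Rightarrow> real"
  assumes "smooth f"
  shows "(f has_real_derivative deriv f x) (at x)"
proof -
  have "Ck (Suc 0) f" using assms unfolding smooth_def by blast
  then have "f differentiable (at x)" by simp
  then show ?thesis
    using DERIV_deriv_iff_real_differentiable by blast
qed

lemma smooth_deriv:
  fixes f :: "real \<Rightarrow> real"
  assumes "smooth f"
  shows "smooth (deriv f)"
proof -
  have "Ck k (\<lambda>x. frechet_derivative f (at x) 1)" for k
    using assms unfolding smooth_def by (metis Ck.simps(2) Basis_real_def singletonI)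
  moreover have "(\<lambda>x. frechet_derivative f (at x) 1) = deriv f"
    using frechet_derivative_real[OF smooth_has_real_derivative[OF assms], where h = 1] by auto
  ultimately show ?thesis unfolding smooth_def by simp
qed

lemma smooth_continuous_on: "smooth f \<Longrightarrow> continuous_on S f"
  unfolding smooth_def by (metis Ck.simps(1) continuous_on_subset subset_UNIV)

lemma smooth_mult:
  fixes f g :: "'a::euclidean_space \<Rightarrow> real"
  shows "smooth f \<Longrightarrow> smooth g \<Longrightarrow> smooth (\<lambda>x. f x * g x)"
  unfolding smooth_def by (auto intro: Ck_mult)

lemma smooth_scaleR: "smooth f \<Longrightarrow> smooth g \<Longrightarrow> smooth (\<lambda>x. f x *\<^sub>R g x)"
  unfolding smooth_def by (auto intro: Ck_scaleR)

lemma smooth_const: "smooth (\<lambda>x. c)"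
  unfolding smooth_def by (auto intro: Ck_const)

lemma smooth_compose_affine:
  fixes f :: "real \<Rightarrow> 'b::real_normed_vector"
  shows "bounded_linear L \<Longrightarrow> smooth f \<Longrightarrow> smooth (\<lambda>x. f (L x + c))"
  unfolding smooth_def by (auto intro: Ck_compose_affine)

lemma smooth_compose_linear:
  fixes f :: "real \<Rightarrow> 'b::real_normed_vector"
  shows "bounded_linear L \<Longrightarrow> smooth f \<Longrightarrow> smooth (\<lambda>x. f (L x))"
  using smooth_compose_affine[of L f 0] by simp

lemma smooth_bounded_linear: "bounded_linear L \<Longrightarrow> smooth f \<Longrightarrow> smooth (\<lambda>x. L (f x))"
  unfolding smooth_def by (auto intro: Ck_bounded_linear)

lemma smooth_add: "smooth f \<Longrightarrow> smooth g \<Longrightarrow> smooth (\<lambda>x. f x + g x)"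
  unfolding smooth_def by (auto intro: Ck_add)

lemma smooth_diff: "smooth f \<Longrightarrow> smooth g \<Longrightarrow> smooth (\<lambda>x. f x - g x)"
  using smooth_add[of f "\<lambda>x. - g x"]
    smooth_bounded_linear[OF bounded_linear_minus[OF bounded_linear_ident], of g] by simp

section \<open>A smooth step\<close>

text \<open>The exponent is a parameter because the family spans a space closed under
  differentiation: a single induction then makes every member smooth. The case \<open>n = 0\<close>
  is the classical flat function exp(-1/x).\<close>

definition flat_exp :: "nat \<Rightarrow> real \<Rightarrow> real" where
  "flat_exp n x = (if x > 0 then inverse x ^ n * exp (- inverse x) else 0)"

lemma flat_exp_tendsto_0: "(flat_exp n \<longlongrightarrow> 0) (at 0)"
proof -
  have "((\<lambda>y::real. y ^ n / exp y) \<longlongrightarrow> 0) at_top"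
    by (rule tendsto_power_div_exp_0)
  then have "((\<lambda>x. inverse x ^ n / exp (inverse x)) \<longlongrightarrow> 0) (at_right (0::real))"
    by (rule filterlim_compose[OF _ filterlim_inverse_at_top_right])
  moreover have "\<forall>\<^sub>F x in at_right 0. inverse x ^ n / exp (inverse x) = flat_exp n x"
    by (auto simp: eventually_at_right_field flat_exp_def exp_minus field_simps intro!: exI[of _ 1])
  ultimately have 1: "(flat_exp n \<longlongrightarrow> 0) (at_right 0)"
    using tendsto_cong by force
  have "\<forall>\<^sub>F x in at_left 0. 0 = flat_exp n x"
    by (auto simp: eventually_at_left_field flat_exp_def intro!: exI[of _ "-1"])
  then have 2: "(flat_exp n \<longlongrightarrow> 0) (at_left 0)"
    using tendsto_cong[of "\<lambda>_. 0" "flat_exp n"] by force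
  from 1 2 show ?thesis by (simp add: filterlim_split_at)
qed

lemma flat_exp_DERIV:
  "(flat_exp n has_real_derivative (flat_exp (n + 2) x - n * flat_exp (Suc n) x)) (at x)"
proof (cases "x = 0")
  case True
  \<comment> \<open>At 0 the difference quotient of one member is the next member of the family,
    which tends to 0.\<close>
  have "((\<lambda>y. (flat_exp n y - flat_exp n 0) / (y - 0)) \<longlongrightarrow> 0) (at 0)"
  proof (rule Lim_transform_eventually[OF flat_exp_tendsto_0[of "Suc n"]])
    show "\<forall>\<^sub>F y in at 0. flat_exp (Suc n) y = (flat_exp n y - flat_exp n 0) / (y - 0)"
      by (auto simp: flat_exp_def eventually_at_filter field_simps)
  qed
  then show ?thesis
    using True by (simp add: has_field_derivative_iff flat_exp_def)
next
  case False
  show ?thesis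
  proof (cases "x > 0")
    case True
    have "((\<lambda>x. inverse x ^ n * exp (- inverse x)) has_real_derivative
       (inverse x ^ (n + 2) * exp (- inverse x) - n * (inverse x ^ Suc n * exp (- inverse x)))) (at x)"
      proof -
      have inv: "(inverse has_real_derivative - (inverse x * inverse x)) (at x)"
        using True by (auto intro!: derivative_eq_intros)
      show ?thesis
        by (rule DERIV_cong[OF DERIV_mult[OF DERIV_power[OF inv] DERIV_fun_exp[OF DERIV_minus[OF inv]]]])
          (cases n; simp add: algebra_simps)
    qed
    moreover have "\<forall>\<^sub>F y in nhds x. flat_exp n y = inverse y ^ n * exp (- inverse y)"
      using eventually_nhds_in_open[of "{0<..}" x] True
      by (auto simp: flat_exp_def elim!: eventually_mono)
    ultimately show ?thesis
      using True by (subst DERIV_cong_ev[OF refl _ refl]) (auto simp: flat_exp_def)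
  next
    case F: False
    have "\<forall>\<^sub>F y in nhds x. flat_exp n y = 0"
      using eventually_nhds_in_open[of "{..<0}" x] F False
      by (auto simp: flat_exp_def elim!: eventually_mono)
    then show ?thesis
      using F by (subst DERIV_cong_ev[OF refl _ refl]) (auto simp: flat_exp_def)
  qed
qed

lemma smooth_flat_exp: "smooth (flat_exp n)"
proof -
  have "Ck k (flat_exp n)" for k n
  proof (induction k arbitrary: n)
    case 0
    show ?case
      using DERIV_isCont[OF flat_exp_DERIV] by (auto intro: continuous_at_imp_continuous_on)
  next
    case (Suc k)
    have "Ck k (\<lambda>x. flat_exp (n + 2) x + (- real n) * flat_exp (Suc n) x)"
      by (intro Ck_add Suc Ck_mult Ck_const)
    then show ?case
      by (intro Ck_real_Suc_I[OF flat_exp_DERIV]) simp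
  qed
  then show ?thesis by (simp add: smooth_def)
qed

text \<open>The standard smooth transition from 0 to 1 on the unit interval. The denominator never
  vanishes, since x or 1 - x is positive.\<close>

definition step :: "real \<Rightarrow> real" where
  "step x = flat_exp 0 x * inverse (flat_exp 0 x + flat_exp 0 (1 - x))"

lemma step_denominator_pos: "flat_exp 0 x + flat_exp 0 (1 - x) > 0"
  by (auto simp: flat_exp_def add_pos_nonneg)

lemma smooth_step: "smooth step"
proof -
  have "smooth (\<lambda>x. flat_exp 0 ((- x) + 1))"
    by (rule smooth_compose_affine[OF bounded_linear_minus[OF bounded_linear_ident] smooth_flat_exp])
  then have "smooth (\<lambda>x. flat_exp 0 x + flat_exp 0 (1 - x))"
    by (intro smooth_add smooth_flat_exp) (simp add: algebra_simps)
  then have "smooth (\<lambda>x. inverse (flat_exp 0 x + flat_exp 0 (1 - x)))"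
    using step_denominator_pos by (auto simp: smooth_def less_imp_neq[symmetric] intro!: Ck_inverse)
  then have "smooth (\<lambda>x. step x)"
    unfolding step_def by (intro smooth_mult smooth_flat_exp)
  then show ?thesis by simp
qed

lemma step_eq_0: "x \<le> 0 \<Longrightarrow> step x = 0"
  and step_eq_1: "x \<ge> 1 \<Longrightarrow> step x = 1"
  by (auto simp: step_def flat_exp_def)

lemma step_nonneg: "0 \<le> step x"
  by (auto simp: step_def flat_exp_def)

lemma step_le_1: "step x \<le> 1"
proof -
  have "0 \<le> flat_exp 0 (1 - x)" by (simp add: flat_exp_def)
  then show ?thesis
    using step_denominator_pos[of x] by (simp add: step_def field_simps)
qed

lemma step_mono: "x \<le> y \<Longrightarrow> step x \<le> step y"
proof -
  assume xy: "x \<le> y"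
  have m: "flat_exp 0 x \<le> flat_exp 0 y" if "x \<le> y" for x y
    using that by (auto simp: flat_exp_def le_imp_inverse_le)
  \<comment> \<open>This is the claim with denominators cleared; the product
    \<open>flat_exp 0 x * flat_exp 0 y\<close> appears on both sides and cancels.\<close>
  have "flat_exp 0 x * flat_exp 0 (1 - y) \<le> flat_exp 0 y * flat_exp 0 (1 - x)"
    using xy by (intro mult_mono m) (auto simp: flat_exp_def)
  then show ?thesis
    using step_denominator_pos[of x] step_denominator_pos[of y]
    by (simp add: step_def field_simps)
qed

text \<open>A negative derivative would make \<open>step\<close> decrease immediately to the right.
  The sign serves twice: in the bounds for the wall cutoff, and to make derivatives of ramps in time
  nonnegative averaging kernels.\<close>

lemma step_deriv_nonneg: "0 \<le> deriv step x"
proof (rule ccontr)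
  assume "\<not> ?thesis"
  then have "deriv step x < 0" by simp
  from DERIV_neg_dec_right[OF smooth_has_real_derivative[OF smooth_step] this]
  obtain d where "0 < d" and d: "\<And>h. 0 < h \<Longrightarrow> h < d \<Longrightarrow> step (x + h) < step x" by auto
  then have "0 < d / 2" "d / 2 < d" by auto
  with d[of "d/2"] step_mono[of x "x + d/2"] show False by linarith
qed

lemma step_deriv_eq_0: "x < 0 \<or> 1 < x \<Longrightarrow> deriv step x = 0"
proof -
  assume "x < 0 \<or> 1 < x"
  then have "\<forall>\<^sub>F y in nhds x. step y = (if x < 0 then 0 else 1)"
    using eventually_nhds_in_open[of "{..<0}" x] eventually_nhds_in_open[of "{1<..}" x]
    by (auto elim!: eventually_mono simp: step_eq_0 step_eq_1)
  then show ?thesis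
    by (auto intro!: DERIV_imp_deriv simp: DERIV_cong_ev[OF refl _ refl])
qed

text \<open>The derivative lives on a compact interval. This \<open>B\<close> is the only
  non-explicit ingredient of the universal constant.\<close>

lemma step_deriv_bounded: "\<exists>B>0. \<forall>x. deriv step x \<le> B"
proof -
  have "compact (deriv step ` {0..1})"
    by (intro compact_continuous_image smooth_continuous_on smooth_deriv smooth_step) auto
  then have "bounded (deriv step ` {0..1})" by (rule compact_imp_bounded)
  then obtain B where B: "B > 0" "\<And>x. x \<in> {0..1} \<Longrightarrow> \<bar>deriv step x\<bar> \<le> B"
    by (auto simp: bounded_pos)
  have "deriv step x \<le> B" for x
    using B(2)[of x] B(1) step_deriv_eq_0[of x] by (cases "x \<in> {0..1}") auto
  with B(1) show ?thesis by blast
qed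

section \<open>Square-integrable functions\<close>

lemma in_L2_iff:
  "in_L2 S f \<longleftrightarrow> f \<in> borel_measurable (lebesgue_on S) \<and> integrable (lebesgue_on S) (\<lambda>x. f x \<bullet> f x)"
proof -
  have "L2sq S f = (\<integral>\<^sup>+ x. ennreal (norm (f x \<bullet> f x)) \<partial>lebesgue_on S)"
    unfolding L2sq_def by (simp add: power2_norm_eq_inner)
  then show ?thesis
    unfolding in_L2_def integrable_iff_bounded by (auto intro: borel_measurable_inner)
qed

lemma in_L2_measurable: "in_L2 S f \<Longrightarrow> f \<in> borel_measurable (lebesgue_on S)"
  by (simp add: in_L2_def)

lemma L2sq_eq_L2_inner: "in_L2 S f \<Longrightarrow> L2sq S f = ennreal (L2_inner S f f)"
  unfolding in_L2_iff L2sq_def L2_inner_def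
  by (subst nn_integral_eq_integral[symmetric]) (auto simp: power2_norm_eq_inner)

lemma L2_inner_self_nonneg: "0 \<le> L2_inner S f f"
  unfolding L2_inner_def by (intro integral_nonneg_AE) auto

lemma enn2real_L2sq: "in_L2 S f \<Longrightarrow> enn2real (L2sq S f) = L2_inner S f f"
  by (simp add: L2sq_eq_L2_inner L2_inner_self_nonneg)

lemma integrable_inner_L2:
  assumes f: "in_L2 S f" and g: "in_L2 S g"
  shows "integrable (lebesgue_on S) (\<lambda>x. f x \<bullet> g x)"
proof (rule Bochner_Integration.integrable_bound)
  show "integrable (lebesgue_on S) (\<lambda>x. f x \<bullet> f x + g x \<bullet> g x)"
    using f g by (auto simp: in_L2_iff)
  show "(\<lambda>x. f x \<bullet> g x) \<in> borel_measurable (lebesgue_on S)"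
    using in_L2_measurable[OF f] in_L2_measurable[OF g] by (rule borel_measurable_inner)
  have "\<bar>f x \<bullet> g x\<bar> \<le> f x \<bullet> f x + g x \<bullet> g x" for x
  proof -
    have "\<bar>f x \<bullet> g x\<bar> \<le> norm (f x) * norm (g x)" by (rule Cauchy_Schwarz_ineq2)
    also have "\<dots> \<le> (norm (f x))\<^sup>2 + (norm (g x))\<^sup>2"
      using sum_squares_bound[of "norm (f x)" "norm (g x)"]
        mult_nonneg_nonneg[OF norm_ge_zero[of "f x"] norm_ge_zero[of "g x"]] by linarith
    finally show ?thesis by (simp add: power2_norm_eq_inner)
  qed
  then show "AE x in lebesgue_on S. norm (f x \<bullet> g x) \<le> norm (f x \<bullet> f x + g x \<bullet> g x)"
    by (intro AE_I2) (simp add: inner_ge_zero)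
qed

lemma in_L2_add:
  assumes f: "in_L2 S f" and g: "in_L2 S g"
  shows "in_L2 S (\<lambda>x. f x + g x)"
  using f g integrable_inner_L2[OF f g] unfolding in_L2_iff
  by (auto simp: inner_add_left inner_add_right inner_commute)

lemma in_L2_scaleR: "in_L2 S f \<Longrightarrow> in_L2 S (\<lambda>x. c *\<^sub>R f x)"
  unfolding in_L2_iff by auto

lemma in_L2_diff:
  assumes "in_L2 S f" "in_L2 S g"
  shows "in_L2 S (\<lambda>x. f x - g x)"
  using in_L2_add[OF assms(1) in_L2_scaleR[OF assms(2), of "-1"]] by simp

lemma in_L2_mult_bounded:
  assumes f: "in_L2 S f" and m: "m \<in> borel_measurable (lebesgue_on S)"
    and bound: "\<And>x. x \<in> S \<Longrightarrow> \<bar>m x\<bar> \<le> B"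
  shows "in_L2 S (\<lambda>x. m x *\<^sub>R f x)"
  unfolding in_L2_iff
proof
  show "(\<lambda>x. m x *\<^sub>R f x) \<in> borel_measurable (lebesgue_on S)"
    using m in_L2_measurable[OF f] by (rule borel_measurable_scaleR)
  then have meas: "(\<lambda>x. m x *\<^sub>R f x \<bullet> m x *\<^sub>R f x) \<in> borel_measurable (lebesgue_on S)"
    by (intro borel_measurable_inner)
  show "integrable (lebesgue_on S) (\<lambda>x. m x *\<^sub>R f x \<bullet> m x *\<^sub>R f x)"
  proof (rule Bochner_Integration.integrable_bound[OF _ meas])
    show "integrable (lebesgue_on S) (\<lambda>x. B\<^sup>2 * (f x \<bullet> f x))"
      using f by (simp add: in_L2_iff)
    have "norm (m x *\<^sub>R f x \<bullet> m x *\<^sub>R f x) \<le> norm (B\<^sup>2 * (f x \<bullet> f x))" if "x \<in> S" for x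
    proof -
      have "(m x)\<^sup>2 \<le> B\<^sup>2"
        using bound[OF that] power_mono[of "\<bar>m x\<bar>" B 2] by simp
      then show ?thesis
        by (simp add: power2_eq_square mult.assoc[symmetric] abs_mult mult_right_mono)
    qed
    then show "AE x in lebesgue_on S. norm (m x *\<^sub>R f x \<bullet> m x *\<^sub>R f x) \<le> norm (B\<^sup>2 * (f x \<bullet> f x))"
      by (auto intro!: AE_I2)
  qed
qed

lemma in_L2_inner_const:
  assumes f: "in_L2 S f"
  shows "in_L2 S (\<lambda>x. f x \<bullet> b)"
  unfolding in_L2_iff
proof
  show m: "(\<lambda>x. f x \<bullet> b) \<in> borel_measurable (lebesgue_on S)"
    using in_L2_measurable[OF f] by simp
  show "integrable (lebesgue_on S) (\<lambda>x. (f x \<bullet> b) \<bullet> (f x \<bullet> b))"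
  proof (rule Bochner_Integration.integrable_bound)
    show "integrable (lebesgue_on S) (\<lambda>x. (f x \<bullet> f x) * (b \<bullet> b))"
      using f by (simp add: in_L2_iff)
    show "(\<lambda>x. (f x \<bullet> b) \<bullet> (f x \<bullet> b)) \<in> borel_measurable (lebesgue_on S)"
      using borel_measurable_inner[OF m m] .
    show "AE x in lebesgue_on S. norm ((f x \<bullet> b) \<bullet> (f x \<bullet> b)) \<le> norm ((f x \<bullet> f x) * (b \<bullet> b))"
      using Cauchy_Schwarz_ineq by (intro AE_I2) (force simp: power2_eq_square)
  qed
qed

lemma in_L2_const: "S \<in> lmeasurable \<Longrightarrow> in_L2 S (\<lambda>x. c)"
  unfolding in_L2_iff
  using finite_measure.integrable_const[OF finite_measure_lebesgue_on] by auto

lemma L2_inner_commute: "L2_inner S f g = L2_inner S g f"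
  by (simp add: L2_inner_def inner_commute)

lemma L2_inner_diff_left:
  "in_L2 S f \<Longrightarrow> in_L2 S g \<Longrightarrow> in_L2 S h \<Longrightarrow>
     L2_inner S (\<lambda>x. f x - g x) h = L2_inner S f h - L2_inner S g h"
  unfolding L2_inner_def
  by (simp add: inner_diff_left Bochner_Integration.integral_diff integrable_inner_L2)

lemma L2_inner_diff_right:
  "in_L2 S f \<Longrightarrow> in_L2 S g \<Longrightarrow> in_L2 S h \<Longrightarrow>
     L2_inner S h (\<lambda>x. f x - g x) = L2_inner S h f - L2_inner S h g"
  using L2_inner_diff_left[of S f g h] by (simp add: L2_inner_commute)

lemma L2_inner_scaleR_left: "L2_inner S (\<lambda>x. c *\<^sub>R f x) g = c * L2_inner S f g"
  by (simp add: L2_inner_def)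

lemma L2_inner_scaleR_right: "L2_inner S f (\<lambda>x. c *\<^sub>R g x) = c * L2_inner S f g"
  by (simp add: L2_inner_def)

lemma L2_inner_diff_self:
  assumes "in_L2 S f" "in_L2 S g"
  shows "L2_inner S (\<lambda>x. f x - g x) (\<lambda>x. f x - g x)
     = L2_inner S f f - 2 * L2_inner S f g + L2_inner S g g"
  using assms by (simp add: L2_inner_diff_left L2_inner_diff_right in_L2_diff L2_inner_commute[of S g f])

lemma L2_inner_le: 
  assumes "in_L2 S f" "in_L2 S g"
  shows "2 * L2_inner S f g \<le> L2_inner S f f + L2_inner S g g"
  using L2_inner_self_nonneg[of S "\<lambda>x. f x - g x"] L2_inner_diff_self[OF assms] by simp

lemma L2_Cauchy_Schwarz:
  assumes f: "in_L2 S f" and g: "in_L2 S g"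
  shows "\<bar>L2_inner S f g\<bar> \<le> sqrt (L2_inner S f f) * sqrt (L2_inner S g g)"
proof -
  define a b c where abc: "a = L2_inner S f f" "b = L2_inner S f g" "c = L2_inner S g g"
  have *: "2 * s * b \<le> a + s\<^sup>2 * c" for s
    using L2_inner_le[OF f in_L2_scaleR[OF g, of s]]
    unfolding L2_inner_scaleR_right L2_inner_scaleR_left abc by (simp add: power2_eq_square)
  have nn: "a \<ge> 0" "c \<ge> 0" unfolding abc by (auto intro: L2_inner_self_nonneg)
  have "b\<^sup>2 \<le> a * c"
  proof (cases "c = 0")
    case True
    have "b = 0"
    proof (rule ccontr)
      assume "b \<noteq> 0"
      \<comment> \<open>With c = 0 the quadratic inequality is linear in s; this s turns it into a +
        1 \<le> a.\<close>
      with *[of "(a + 1) / (2 * b)"] True show False by simp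
    qed
    then show ?thesis using nn by simp
  next
    case False
    with nn have "c > 0" by simp
    then have "2 * b\<^sup>2 / c \<le> a + b\<^sup>2 / c"
      \<comment> \<open>The choice b / c minimises a - 2 s b + s^2 c.\<close>
      using *[of "b / c"] by (simp add: power2_eq_square field_simps)
    with \<open>c > 0\<close> show ?thesis by (simp add: field_simps)
  qed
  then have "sqrt (b\<^sup>2) \<le> sqrt (a * c)" by (rule real_sqrt_le_mono)
  then show ?thesis unfolding abc by (simp add: real_sqrt_mult)
qed

text \<open>Meant for the smooth approximants in \<open>H10\<close>. Membership of
  \<open>f k\<close> in L2 is available only eventually, once the distance to \<open>g\<close> is
  finite, and that is enough for the limit.\<close>

lemma L2_strong_convergence_inner:
  fixes f :: "nat \<Rightarrow> 'a::euclidean_space \<Rightarrow> 'b::euclidean_space"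
  assumes meas: "\<And>k. f k \<in> borel_measurable (lebesgue_on S)"
    and g: "in_L2 S g" and w: "in_L2 S w"
    and lim: "(\<lambda>k. L2sq S (\<lambda>x. f k x - g x)) \<longlonglongrightarrow> 0"
  shows "(\<lambda>k. L2_inner S (f k) w) \<longlonglongrightarrow> L2_inner S g w"
proof -
  let ?d = "\<lambda>k x. f k x - g x"
  have "\<forall>\<^sub>F k in sequentially. L2sq S (?d k) < 1"
    using lim by (rule order_tendstoD) simp
  then have L2: "\<forall>\<^sub>F k in sequentially. in_L2 S (?d k)"
    by eventually_elim (use meas in_L2_measurable[OF g] in
        \<open>auto simp: in_L2_def intro: order.strict_trans\<close>)
  have "(\<lambda>k. enn2real (L2sq S (?d k))) \<longlonglongrightarrow> 0"
    by (rule tendsto_enn2real) (use lim in auto)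
  then have 1: "(\<lambda>k. sqrt (enn2real (L2sq S (?d k))) * sqrt (L2_inner S w w)) \<longlonglongrightarrow> 0"
    using tendsto_mult_left_zero[OF tendsto_real_sqrt[of _ 0, unfolded real_sqrt_zero]] by blast
  have "\<forall>\<^sub>F k in sequentially. norm (L2_inner S (f k) w - L2_inner S g w)
      \<le> sqrt (enn2real (L2sq S (?d k))) * sqrt (L2_inner S w w)"
    using L2
  proof eventually_elim
    case (elim k)
    have "in_L2 S (f k)" using in_L2_add[OF elim g] by simp
    then show ?case
      using L2_Cauchy_Schwarz[OF elim w] g w by (simp add: L2_inner_diff_left enn2real_L2sq[OF elim])
  qed
  from Lim_null_comparison[OF this 1] show ?thesis
    by (rule LIM_zero_cancel)
qed

section \<open>Fubini's theorem for the completed measure\<close>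

text \<open>The set where \<open>f\<close> and \<open>g\<close> differ lies in a null set, and all
  its subsets are measurable for the completion. Thus a slice known only up to null sets is still
  measurable.\<close>

lemma borel_measurable_completion_AE:
  assumes g: "g \<in> borel_measurable M" and ae: "AE x in M. f x = g x"
  shows "f \<in> borel_measurable (completion M)"
proof -
  obtain N where N: "N \<in> null_sets M" "{x\<in>space M. f x \<noteq> g x} \<subseteq> N"
    using ae by (auto elim!: AE_E)
  show ?thesis
  proof (rule measurableI)
    fix A :: "'b set" assume A: "A \<in> sets borel"
    have eq: "f -` A \<inter> space M = ((g -` A \<inter> space M) - N) \<union> (f -` A \<inter> space M \<inter> N)"
      using N(2) by auto
    have "f -` A \<inter> space M \<inter> N \<in> null_sets (completion M)"
      using null_sets_completion_subset[OF _ N(1)[THEN null_sets_completionI], of "f -` A \<inter> space M \<inter> N"]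
      by simp
    moreover have "(g -` A \<inter> space M) - N \<in> sets (completion M)"
      using measurable_sets[OF g A] N(1) by auto
    ultimately show "f -` A \<inter> space (completion M) \<in> sets (completion M)"
      unfolding space_completion by (subst eq) (blast intro: null_setsD2 sets.Un)
  qed simp
qed

text \<open>Lebesgue measure on the product is the completion of a product measure, so slices of
  \<open>h\<close> are measurable only for almost every \<open>t\<close>. A Borel function
  \<open>g\<close> that agrees with \<open>h\<close> almost everywhere agrees with it on almost
  every slice; Fubini for \<open>g\<close> is then transported back.\<close>

lemma
  fixes h :: "'a::euclidean_space \<times> 'b::euclidean_space \<Rightarrow> real"
  assumes h: "integrable lebesgue h"
  shows AE_integrable_lebesgue_fst: "AE t in lebesgue. integrable lebesgue (\<lambda>x. h (t, x))"
    and integrable_lebesgue_fst: "integrable lebesgue (\<lambda>t. \<integral>x. h (t, x) \<partial>lebesgue)"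
    and integral_lebesgue_fst: "(\<integral>t. (\<integral>x. h (t, x) \<partial>lebesgue) \<partial>lebesgue) = (\<integral>z. h z \<partial>lebesgue)"
proof -
  obtain g where g[measurable]: "g \<in> borel_measurable lborel" and ae: "AE z in lborel. h z = g z"
    using completion_ex_borel_measurable_real[of h lborel] borel_measurable_integrable[OF h] by blast
  have "integrable lebesgue g"
    by (rule integrable_cong_AE_imp[OF h measurable_completion[OF g] AE_completion[OF ae]])
  then have gi: "integrable (lborel \<Otimes>\<^sub>M lborel) g"
    using integrable_completion[OF g] by (simp add: lborel_prod)
  have ae2: "AE t in lborel. AE x in lborel. h (t, x) = g (t, x)"
    using lborel_pair.AE_pair[OF ae[folded lborel_prod]] .
  have gm: "g \<in> borel_measurable (lborel \<Otimes>\<^sub>M lborel)"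
    using gi by (rule borel_measurable_integrable)
  have slice_m: "(\<lambda>x. g (t, x)) \<in> borel_measurable lborel" for t
    using measurable_compose[OF measurable_Pair1' gm, of t] by simp
  have "AE t in lborel. integrable lebesgue (\<lambda>x. h (t, x)) \<and>
      (\<integral>x. h (t, x) \<partial>lebesgue) = (\<integral>x. g (t, x) \<partial>lborel)"
    using ae2 lborel_pair.AE_integrable_fst'[OF gi]
  proof eventually_elim
    case (elim t)
    have m: "(\<lambda>x. h (t, x)) \<in> borel_measurable lebesgue"
      using slice_m[of t] elim(1) by (rule borel_measurable_completion_AE)
    have i: "integrable lebesgue (\<lambda>x. g (t, x))"
      using elim(2) integrable_completion[OF slice_m[of t]] by simp
    have ae: "AE x in lebesgue. h (t, x) = g (t, x)"
      using elim(1) by (rule AE_completion)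
    have "(\<integral>x. h (t, x) \<partial>lebesgue) = (\<integral>x. g (t, x) \<partial>lebesgue)"
      using ae by (intro integral_cong_AE m measurable_completion slice_m)
    moreover have "integrable lebesgue (\<lambda>x. h (t, x))"
      by (rule integrable_cong_AE_imp[OF i m AE_symmetric[OF ae]])
    ultimately show ?case
      using integral_completion[OF slice_m[of t]] by simp
  qed
  then have ae1: "AE t in lborel. integrable lebesgue (\<lambda>x. h (t, x))"
    and ae3: "AE t in lborel. (\<integral>x. h (t, x) \<partial>lebesgue) = (\<integral>x. g (t, x) \<partial>lborel)"
    by auto
  have gfst: "integrable lborel (\<lambda>t. \<integral>x. g (t, x) \<partial>lborel)"
    using lborel_pair.integrable_fst'[OF gi] .
  have hm: "(\<lambda>t. \<integral>x. h (t, x) \<partial>lebesgue) \<in> borel_measurable lebesgue"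
    using borel_measurable_integrable[OF gfst] ae3 by (rule borel_measurable_completion_AE)
  have gfst': "integrable lebesgue (\<lambda>t. \<integral>x. g (t, x) \<partial>lborel)"
    using gfst integrable_completion[OF borel_measurable_integrable[OF gfst]] by simp
  show "AE t in lebesgue. integrable lebesgue (\<lambda>x. h (t, x))"
    using ae1 by (rule AE_completion)
  show "integrable lebesgue (\<lambda>t. \<integral>x. h (t, x) \<partial>lebesgue)"
    by (rule integrable_cong_AE_imp[OF gfst' hm AE_symmetric[OF AE_completion[OF ae3]]])
  have "(\<integral>t. (\<integral>x. h (t, x) \<partial>lebesgue) \<partial>lebesgue) = (\<integral>t. (\<integral>x. g (t, x) \<partial>lborel) \<partial>lebesgue)"
    using AE_completion[OF ae3] by (intro integral_cong_AE hm borel_measurable_integrable[OF gfst'])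
  also have "\<dots> = (\<integral>t. (\<integral>x. g (t, x) \<partial>lborel) \<partial>lborel)"
    by (rule integral_completion[OF borel_measurable_integrable[OF gfst]])
  also have "\<dots> = (\<integral>z. g z \<partial>lborel)"
    using lborel_pair.integral_fst'[OF gi] by (simp add: lborel_prod)
  also have "\<dots> = (\<integral>z. g z \<partial>lebesgue)"
    by (rule integral_completion[OF g, symmetric])
  also have "\<dots> = (\<integral>z. h z \<partial>lebesgue)"
    using AE_completion[OF ae] borel_measurable_integrable[OF h] measurable_completion[OF g]
    by (intro integral_cong_AE) auto
  finally show "(\<integral>t. (\<integral>x. h (t, x) \<partial>lebesgue) \<partial>lebesgue) = (\<integral>z. h z \<partial>lebesgue)" .
qed

lemma
  fixes h :: "'a::euclidean_space \<Rightarrow> 'b::euclidean_space \<Rightarrow> real"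
  assumes S: "S \<in> sets borel" and T: "T \<in> sets borel"
    and h: "integrable (lebesgue_on (S \<times> T)) (\<lambda>(t, x). h t x)"
  shows AE_integrable_lebesgue_on_fst: "AE t in lebesgue_on S. integrable (lebesgue_on T) (h t)"
    and integrable_lebesgue_on_fst: "integrable (lebesgue_on S) (\<lambda>t. \<integral>x. h t x \<partial>lebesgue_on T)"
    and integral_lebesgue_on_fst:
      "(\<integral>t. (\<integral>x. h t x \<partial>lebesgue_on T) \<partial>lebesgue_on S) = (\<integral>(t, x). h t x \<partial>lebesgue_on (S \<times> T))"
proof -
  have ST: "S \<times> T \<in> sets lebesgue"
    using borel_Times[OF S T] by (simp add: sets_completionI_sets)
  have S': "S \<in> sets lebesgue" and T': "T \<in> sets lebesgue"
    using S T by (auto intro: sets_completionI_sets)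
  define H where "H z = indicat_real (S \<times> T) z *\<^sub>R (case z of (t, x) \<Rightarrow> h t x)" for z
  have Hi: "integrable lebesgue H"
    unfolding H_def using h ST by (simp add: integrable_restrict_space)
  have H: "H (t, x) = indicat_real S t *\<^sub>R (indicat_real T x *\<^sub>R h t x)" for t x
    by (simp add: H_def indicator_times)
  have slice: "(\<integral>x. H (t, x) \<partial>lebesgue) = indicat_real S t *\<^sub>R (\<integral>x. h t x \<partial>lebesgue_on T)" for t
    unfolding H using T' by (simp add: integral_restrict_space)
  show "AE t in lebesgue_on S. integrable (lebesgue_on T) (h t)"
    unfolding AE_restrict_space_iff[of S lebesgue, simplified, OF S']
    using AE_integrable_lebesgue_fst[OF Hi]
    by eventually_elim (auto simp: H integrable_restrict_space T')
  show "integrable (lebesgue_on S) (\<lambda>t. \<integral>x. h t x \<partial>lebesgue_on T)"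
    using integrable_lebesgue_fst[OF Hi] unfolding slice by (simp add: integrable_restrict_space S')
  show "(\<integral>t. (\<integral>x. h t x \<partial>lebesgue_on T) \<partial>lebesgue_on S) = (\<integral>(t, x). h t x \<partial>lebesgue_on (S \<times> T))"
    using integral_lebesgue_fst[OF Hi] unfolding slice
    by (simp add: integral_restrict_space S' ST H_def)
qed

text \<open>Measurability is demanded of \<open>f\<close> alone, as completeness passes it on to
  \<open>g\<close>. This is what integrals in time require when one integrand, such as the norm of
  \<open>G t\<close>, is understood only for almost every \<open>t\<close>.\<close>

lemma integral_cong_AE_lebesgue_on:
  fixes f g :: "'a::euclidean_space \<Rightarrow> real"
  assumes S: "S \<in> sets lebesgue" and f: "f \<in> borel_measurable (lebesgue_on S)"
    and ae: "AE x in lebesgue_on S. f x = g x"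
  shows "(\<integral>x. f x \<partial>lebesgue_on S) = (\<integral>x. g x \<partial>lebesgue_on S)"
proof -
  obtain h where h: "h \<in> borel_measurable lborel" and eq: "AE x in lborel. (if x \<in> S then f x else 0) = h x"
    using completion_ex_borel_measurable_real[OF borel_measurable_if_I[OF f S]]
    by (elim bexE) (rule that)
  have "AE x in lborel. (if x \<in> S then g x else 0) = h x"
  proof -
    have "AE x in lborel. x \<in> S \<longrightarrow> f x = g x"
      using ae S by (simp add: AE_restrict_space_iff AE_completion_iff)
    with eq show ?thesis by eventually_elim auto
  qed
  from borel_measurable_if_D[OF borel_measurable_completion_AE[OF h this]]
  have "g \<in> borel_measurable (lebesgue_on S)" .
  then show ?thesis
    using ae f by (intro integral_cong_AE)
qed

section \<open>The cell and functions of the vertical coordinate\<close>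

lemma cell_eq_box: "(cell :: (real^'n) set) = box 0 1"
  by (auto simp: cell_def mem_box_cart)

lemma cell_borel: "(cell :: (real^'n) set) \<in> sets borel"
  by (simp add: cell_eq_box)

lemma cell_lmeasurable: "(cell :: (real^'n) set) \<in> lmeasurable"
  by (simp add: cell_eq_box)

lemma cell_sets_lebesgue: "(cell :: (real^'n) set) \<in> sets lebesgue"
  by (rule fmeasurableD[OF cell_lmeasurable])

lemma measurable_continuous_cell:
  fixes f :: "real^'n \<Rightarrow> 'b::euclidean_space"
  shows "continuous_on UNIV f \<Longrightarrow> f \<in> borel_measurable (lebesgue_on cell)"
  using cell_sets_lebesgue
  by (intro continuous_imp_measurable_on_sets_lebesgue) (auto intro: continuous_on_subset)

lemma bounded_continuous_cell:
  fixes f :: "real^'n \<Rightarrow> 'b::real_normed_vector"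
  assumes "continuous_on UNIV f"
  obtains B where "\<forall>x\<in>cell. norm (f x) \<le> B"
proof -
  have "compact (f ` cbox 0 1)"
    by (intro compact_continuous_image continuous_on_subset[OF assms]) auto
  then obtain B where "\<And>x. x \<in> cbox 0 1 \<Longrightarrow> norm (f x) \<le> B"
    using compact_imp_bounded[of "f ` cbox 0 1"] by (force simp: bounded_iff)
  then have "\<forall>x\<in>cell. norm (f x) \<le> B"
    using subsetD[OF box_subset_cbox[of "0::real^'n" 1]] by (simp add: cell_eq_box)
  then show ?thesis by (rule that)
qed

lemma in_L2_cell_continuous:
  fixes f :: "real^'n \<Rightarrow> 'b::euclidean_space"
  assumes "continuous_on UNIV f"
  shows "in_L2 cell f"
  unfolding in_L2_iff
proof
  show m: "f \<in> borel_measurable (lebesgue_on cell)"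
    using assms by (rule measurable_continuous_cell)
  obtain B where B: "\<forall>x\<in>cell. norm (f x) \<le> B"
    by (rule bounded_continuous_cell[OF assms])
  show "integrable (lebesgue_on cell) (\<lambda>x. f x \<bullet> f x)"
  proof (rule finite_measure.integrable_const_bound[OF finite_measure_lebesgue_on[OF cell_lmeasurable]])
    show "(\<lambda>x. f x \<bullet> f x) \<in> borel_measurable (lebesgue_on cell)"
      using borel_measurable_inner[OF m m] .
    show "AE x in lebesgue_on cell. norm (f x \<bullet> f x) \<le> B\<^sup>2"
      using B by (intro AE_I2) (auto simp: power2_norm_eq_inner[symmetric] intro!: power_mono)
  qed
qed

lemma in_L2_cell_mult_continuous:
  fixes f :: "real^'n \<Rightarrow> 'b::euclidean_space"
  assumes "in_L2 cell f" and m: "continuous_on UNIV m"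
  shows "in_L2 cell (\<lambda>x. m x *\<^sub>R f x)"
proof -
  obtain B where "\<forall>x\<in>cell. norm (m x) \<le> B"
    by (rule bounded_continuous_cell[OF m])
  then show ?thesis
    using measurable_continuous_cell[OF m] by (intro in_L2_mult_bounded[OF assms(1)]) auto
qed

lemma continuous_on_vertical:
  fixes g :: "real \<Rightarrow> 'b::topological_space"
  shows "continuous_on UNIV g \<Longrightarrow> continuous_on UNIV (\<lambda>x :: real^'n. g (x $ v))"
  by (auto intro!: continuous_on_compose2[of UNIV g] continuous_intros)

section \<open>Layers along the walls: slabs, exponential weight, cutoff\<close>

definition wall_slab :: "'n::finite \<Rightarrow> real \<Rightarrow> (real^'n) set" where
  "wall_slab v s = {x \<in> cell. x $ v \<le> s \<or> 1 - s \<le> x $ v}"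

lemma wall_slab_lmeasurable:
  fixes v :: "'n::finite"
  shows "wall_slab v s \<in> lmeasurable"
proof -
  have "closed {x::real^'n. x $ v \<le> s \<or> 1 - s \<le> x $ v}"
    by (auto intro!: closed_Collect_disj closed_Collect_le continuous_intros)
  then have "cell \<inter> {x::real^'n. x $ v \<le> s \<or> 1 - s \<le> x $ v} \<in> lmeasurable"
    by (intro fmeasurable_Int_fmeasurable cell_lmeasurable) auto
  then show ?thesis by (simp add: wall_slab_def Collect_conj_eq)
qed

lemma measure_wall_slab:
  fixes v :: "'n::finite"
  assumes s: "0 \<le> s" "s \<le> 1"
  shows "measure lebesgue (wall_slab v s) \<le> 2 * s"
proof -
  define b :: "real^'n" where "b = (\<chi> i. if i = v then s else 1)"
  define a :: "real^'n" where "a = (\<chi> i. if i = v then 1 - s else 0)"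
  have nonempty: "cbox 0 b \<noteq> {}" "cbox a 1 \<noteq> {}"
    using s by (auto simp: interval_ne_empty_cart a_def b_def)
  have "measure lebesgue (cbox 0 b) = (\<Prod>i\<in>UNIV. if i = v then s else 1)"
    using content_cbox_cart[OF nonempty(1)] by (simp add: b_def)
  then have 1: "measure lebesgue (cbox 0 b) = s" by simp
  have "measure lebesgue (cbox a 1) = (\<Prod>i\<in>UNIV. if i = v then s else 1)"
    using content_cbox_cart[OF nonempty(2)] by (simp add: a_def if_distrib cong: if_cong)
  then have 2: "measure lebesgue (cbox a 1) = s" by simp
  have "wall_slab v s \<subseteq> cbox 0 b \<union> cbox a 1"
    by (auto simp: wall_slab_def cell_def mem_box_cart a_def b_def less_imp_le not_less_iff_gr_or_eq
        split: if_splits)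
  then have "measure lebesgue (wall_slab v s) \<le> measure lebesgue (cbox 0 b \<union> cbox a 1)"
    by (intro measure_mono_fmeasurable fmeasurableD[OF wall_slab_lmeasurable]) auto
  also have "\<dots> \<le> measure lebesgue (cbox 0 b) + measure lebesgue (cbox a 1)"
    by (rule measure_Un_le) auto
  finally show ?thesis using 1 2 by simp
qed

text \<open>A smooth surrogate for the indicator of both layers. The exponentials have a smooth
  antiderivative, fit for use in a test function, that is dominated by \<delta> times the weight
  itself.\<close>

definition wall_weight :: "real \<Rightarrow> real \<Rightarrow> real" where
  "wall_weight \<delta> y = exp (- y / \<delta>) + exp (- (1 - y) / \<delta>)"

text \<open>For positive \<delta> the shift by 1 makes the profile vanish up to distance \<delta>
  from the walls, which gives the compact support required of test fields; the transition takes
  place between \<delta> and 2 \<delta>.\<close>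

definition wall_cutoff :: "real \<Rightarrow> real \<Rightarrow> real" where
  "wall_cutoff \<delta> y = step (y / \<delta> - 1) * step ((1 - y) / \<delta> - 1)"

lemma wall_weight_pos: "0 < wall_weight \<delta> y"
  by (simp add: wall_weight_def add_pos_pos)

lemma wall_weight_le: "\<delta> > 0 \<Longrightarrow> 0 \<le> y \<Longrightarrow> y \<le> 1 \<Longrightarrow> wall_weight \<delta> y \<le> 2"
proof -
  assume "\<delta> > 0" "0 \<le> y" "y \<le> 1"
  then have "exp (- y / \<delta>) \<le> 1" "exp (- (1 - y) / \<delta>) \<le> 1"
    by (simp_all add: divide_nonpos_pos)
  then show ?thesis unfolding wall_weight_def by linarith
qed

lemma continuous_wall_weight: "continuous_on UNIV (wall_weight \<delta>)"
  unfolding wall_weight_def by (cases "\<delta> = 0") (auto intro!: continuous_intros)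

lemma smooth_affine: "smooth f \<Longrightarrow> smooth (\<lambda>x::real. (f (a * x + c)) :: 'b::real_normed_vector)"
  by (rule smooth_compose_affine[OF bounded_linear_mult_right])

lemma smooth_wall_cutoff: "smooth (wall_cutoff \<delta>)"
proof -
  have "smooth (\<lambda>y. step ((1 / \<delta>) * y + (- 1)) * step ((- 1 / \<delta>) * y + (1 / \<delta> - 1)))"
    by (intro smooth_mult smooth_affine[of step] smooth_step)
  moreover have "(\<lambda>y. step ((1 / \<delta>) * y + (- 1)) * step ((- 1 / \<delta>) * y + (1 / \<delta> - 1))) = wall_cutoff \<delta>"
    by (auto simp: wall_cutoff_def fun_eq_iff diff_divide_distrib algebra_simps)
  ultimately show ?thesis by simp
qed

lemma wall_cutoff_range: "0 \<le> wall_cutoff \<delta> y" "wall_cutoff \<delta> y \<le> 1"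
  by (auto simp: wall_cutoff_def step_nonneg step_le_1 mult_le_one)

lemma wall_cutoff_support: "\<delta> > 0 \<Longrightarrow> wall_cutoff \<delta> y \<noteq> 0 \<Longrightarrow> \<delta> \<le> y \<and> y \<le> 1 - \<delta>"
  using step_eq_0[of "y / \<delta> - 1"] step_eq_0[of "(1 - y) / \<delta> - 1"]
  by (auto simp: wall_cutoff_def field_simps not_le intro!: leI)

lemma wall_cutoff_eq_1: "\<delta> > 0 \<Longrightarrow> 2 * \<delta> \<le> y \<Longrightarrow> y \<le> 1 - 2 * \<delta> \<Longrightarrow> wall_cutoff \<delta> y = 1"
  by (simp add: wall_cutoff_def step_eq_1 field_simps)

lemma deriv_wall_cutoff:
  assumes "\<delta> \<noteq> 0"
  shows "deriv (wall_cutoff \<delta>) y = deriv step (y / \<delta> - 1) / \<delta> * step ((1 - y) / \<delta> - 1)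
     - step (y / \<delta> - 1) * (deriv step ((1 - y) / \<delta> - 1) / \<delta>)"
proof (rule DERIV_imp_deriv)
  have 1: "((\<lambda>y. step (y / \<delta> - 1)) has_real_derivative deriv step (y / \<delta> - 1) * (1 / \<delta>)) (at y)"
    by (rule DERIV_chain2[OF smooth_has_real_derivative[OF smooth_step]])
      (use assms in \<open>auto intro!: derivative_eq_intros\<close>)
  have 2: "((\<lambda>y. step ((1 - y) / \<delta> - 1)) has_real_derivative
      deriv step ((1 - y) / \<delta> - 1) * (- 1 / \<delta>)) (at y)"
    by (rule DERIV_chain2[OF smooth_has_real_derivative[OF smooth_step]])
      (use assms in \<open>auto intro!: derivative_eq_intros\<close>)
  show "(wall_cutoff \<delta> has_real_derivative deriv step (y / \<delta> - 1) / \<delta> * step ((1 - y) / \<delta> - 1)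
     - step (y / \<delta> - 1) * (deriv step ((1 - y) / \<delta> - 1) / \<delta>)) (at y)"
    unfolding wall_cutoff_def
    by (rule DERIV_cong[OF DERIV_mult[OF 1 2]]) (simp add: algebra_simps)
qed

text \<open>The two walls contribute terms of opposite sign, each at most its own bump because the
  other factor lies between 0 and 1. This holds even where the layers overlap.\<close>

lemma abs_deriv_wall_cutoff_le:
  assumes "\<delta> > 0"
  shows "\<bar>deriv (wall_cutoff \<delta>) y\<bar>
     \<le> (deriv step (y / \<delta> - 1) + deriv step ((1 - y) / \<delta> - 1)) / \<delta>"
proof -
  have "deriv step (y / \<delta> - 1) / \<delta> * step ((1 - y) / \<delta> - 1) \<le> deriv step (y / \<delta> - 1) / \<delta>"
    "step (y / \<delta> - 1) * (deriv step ((1 - y) / \<delta> - 1) / \<delta>) \<le> deriv step ((1 - y) / \<delta> - 1) / \<delta>"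
    using assms
    by (intro mult_left_le mult_left_le_one_le divide_nonneg_pos step_le_1 step_nonneg step_deriv_nonneg; simp)+
  moreover have "0 \<le> deriv step (y / \<delta> - 1) / \<delta> * step ((1 - y) / \<delta> - 1)"
    "0 \<le> step (y / \<delta> - 1) * (deriv step ((1 - y) / \<delta> - 1) / \<delta>)"
    using assms by (auto simp: step_nonneg step_deriv_nonneg)
  ultimately show ?thesis
    using assms deriv_wall_cutoff[of \<delta> y] unfolding add_divide_distrib by linarith
qed

lemma deriv_wall_cutoff_le_weight:
  assumes "\<delta> > 0" and B: "\<And>x. deriv step x \<le> B"
  shows "\<bar>deriv (wall_cutoff \<delta>) y\<bar> \<le> B * exp 2 / \<delta> * wall_weight \<delta> y"
proof -
  \<comment> \<open>The left side vanishes for z > 2, and for z \<le> 2 one has exp(-z) \<ge>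
    exp(-2). This is the origin of the factor exp(2).\<close>
  have *: "deriv step (z - 1) \<le> B * exp 2 * exp (- z)" for z
  proof (cases "z \<le> 2")
    case True
    have "B \<ge> 0" using B[of 0] step_deriv_nonneg[of 0] by simp
    then have "B * 1 \<le> B * exp (2 - z)" using True by (intro mult_left_mono) auto
    also have "\<dots> = B * exp 2 * exp (- z)" by (simp add: exp_diff exp_minus field_simps)
    finally show ?thesis using B[of "z - 1"] by simp
  next
    case False
    have "B \<ge> 0" using B[of 0] step_deriv_nonneg[of 0] by simp
    then show ?thesis using False by (simp add: step_deriv_eq_0)
  qed
  have "\<bar>deriv (wall_cutoff \<delta>) y\<bar>
     \<le> (deriv step (y / \<delta> - 1) + deriv step ((1 - y) / \<delta> - 1)) / \<delta>"
    using assms(1) by (rule abs_deriv_wall_cutoff_le)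
  also have "\<dots> \<le> (B * exp 2 * exp (- (y / \<delta>)) + B * exp 2 * exp (- ((1 - y) / \<delta>))) / \<delta>"
    using *[of "y / \<delta>"] *[of "(1 - y) / \<delta>"] assms(1) by (intro divide_right_mono) auto
  also have "\<dots> = B * exp 2 / \<delta> * wall_weight \<delta> y"
    unfolding wall_weight_def minus_divide_left[symmetric]
    by (simp add: add_divide_distrib distrib_left algebra_simps)
  finally show ?thesis .
qed

text \<open>Complements the bound by the weight: in the viscous term the squared slope is integrated
  alone, and its support of measure at most 4 \<delta> reduces the factor 1/\<delta>^2 to
  1/\<delta>.\<close>

lemma deriv_wall_cutoff_sq_le_indicator:
  assumes "\<delta> > 0" and B: "\<And>x. deriv step x \<le> B" and x: "x \<in> cell"
  shows "(deriv (wall_cutoff \<delta>) (x $ v))\<^sup>2 \<le> (2 * B / \<delta>)\<^sup>2 * indicat_real (wall_slab v (2 * \<delta>)) x"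
proof (cases "x \<in> wall_slab v (2 * \<delta>)")
  case True
  have "\<bar>deriv (wall_cutoff \<delta>) (x $ v)\<bar> \<le> (B + B) / \<delta>"
    using assms(1) by (intro order_trans[OF abs_deriv_wall_cutoff_le] divide_right_mono add_mono B) auto
  then have "\<bar>deriv (wall_cutoff \<delta>) (x $ v)\<bar>\<^sup>2 \<le> (2 * B / \<delta>)\<^sup>2"
    by (intro power_mono) auto
  then show ?thesis using True by simp
next
  case False
  then have "1 < x $ v / \<delta> - 1" "1 < (1 - x $ v) / \<delta> - 1"
    using x assms(1) by (auto simp: wall_slab_def field_simps)
  then have "\<bar>deriv (wall_cutoff \<delta>) (x $ v)\<bar> \<le> 0"
    using abs_deriv_wall_cutoff_le[OF assms(1), of "x $ v"] by (simp add: step_deriv_eq_0)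
  then show ?thesis using False by simp
qed

section \<open>Test fields\<close>

lemma has_derivative_vertical:
  fixes g :: "real \<Rightarrow> real"
  assumes "smooth g"
  shows "((\<lambda>x :: real^'n. g (x $ v)) has_derivative (\<lambda>h. deriv g (x $ v) * h $ v)) (at x)"
proof -
  have "((\<lambda>x :: real^'n. x $ v) has_derivative (\<lambda>h. h $ v)) (at x)"
    by (rule bounded_linear_imp_has_derivative) (rule bounded_linear_vec_nth)
  from has_derivative_compose[OF this smooth_has_real_derivative[OF assms, of "x $ v",
      unfolded has_field_derivative_def]]
  show ?thesis .
qed

lemma smooth_vertical: "smooth g \<Longrightarrow> smooth (\<lambda>x :: real^'n. g (x $ v))"
  by (rule smooth_compose_linear[OF bounded_linear_vec_nth])

lemma jacobian_nth:
  "jacobian f (at x) $ i $ j = frechet_derivative f (at x) (axis j 1) $ i"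
  by (simp add: jacobian_def matrix_def)

text \<open>Supplies test functions for \<open>weak_gradient\<close>: \<open>g\<close> need not
  vanish at the walls, so the compact support is inherited from \<phi>.\<close>

lemma space_test_vertical_mult:
  fixes \<phi> :: "real^'n \<Rightarrow> real^'n"
  assumes \<phi>: "space_test v \<phi>" and g: "smooth g"
  shows "space_test v (\<lambda>x. g (x $ v) * \<phi> x $ i)"
  unfolding space_test_def
proof (intro conjI)
  have "smooth (\<lambda>x. \<phi> x $ i)"
    using \<phi> by (intro smooth_bounded_linear[OF bounded_linear_vec_nth]) (simp add: space_test_def)
  then show "smooth (\<lambda>x. g (x $ v) * \<phi> x $ i)"
    by (intro smooth_mult smooth_vertical g)
  show "horizontally_periodic v (\<lambda>x. g (x $ v) * \<phi> x $ i)"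
    using \<phi> by (auto simp: space_test_def horizontally_periodic_def axis_def)
  show "\<exists>\<delta>>0. \<forall>x. g (x $ v) * \<phi> x $ i \<noteq> 0 \<longrightarrow> \<delta> \<le> x $ v \<and> x $ v \<le> 1 - \<delta>"
    using \<phi> unfolding space_test_def by (metis mult_eq_0_iff zero_index)
qed

lemma frechet_derivative_vertical_mult:
  fixes \<phi> :: "real^'n \<Rightarrow> real^'n"
  assumes \<phi>: "smooth \<phi>" and g: "smooth g"
  shows "frechet_derivative (\<lambda>x. g (x $ v) * \<phi> x $ i) (at x) (axis v 1)
    = deriv g (x $ v) * \<phi> x $ i + g (x $ v) * jacobian \<phi> (at x) $ i $ v"
proof -
  have "Ck (Suc 0) \<phi>" using \<phi> unfolding smooth_def by blast
  then have "(\<phi> has_derivative frechet_derivative \<phi> (at x)) (at x)"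
    by (simp add: frechet_derivative_works)
  then have "((\<lambda>x. \<phi> x $ i) has_derivative (\<lambda>h. frechet_derivative \<phi> (at x) h $ i)) (at x)"
    by (rule bounded_linear.has_derivative[OF bounded_linear_vec_nth])
  from has_derivative_mult[OF has_derivative_vertical[OF g, of v x] this]
  have "frechet_derivative (\<lambda>x. g (x $ v) * \<phi> x $ i) (at x)
     = (\<lambda>h. g (x $ v) * frechet_derivative \<phi> (at x) h $ i + deriv g (x $ v) * h $ v * \<phi> x $ i)"
    by (rule frechet_derivative_at[symmetric])
  then show ?thesis by (simp add: jacobian_nth)
qed

lemma continuous_jacobian_nth:
  fixes \<phi> :: "real^'n \<Rightarrow> real^'m"
  assumes "smooth \<phi>"
  shows "continuous_on UNIV (\<lambda>x. jacobian \<phi> (at x) $ i $ j)"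
proof -
  have "Ck (Suc 0) \<phi>" using assms unfolding smooth_def by blast
  moreover have "(axis j 1 :: real^'n) \<in> Basis" by (simp add: axis_in_Basis_iff)
  ultimately have "continuous_on UNIV (\<lambda>x. frechet_derivative \<phi> (at x) (axis j 1))"
    unfolding Ck.simps by blast
  then show ?thesis unfolding jacobian_nth by (intro continuous_intros)
qed

lemma in_L2_nth: "in_L2 S f \<Longrightarrow> in_L2 S (\<lambda>x. f x $ i)" for f :: "_ \<Rightarrow> real^'n"
  using in_L2_inner_const[of S f "axis i 1"] by (simp add: inner_axis)

lemma in_L2_nth_nth: "in_L2 S f \<Longrightarrow> in_L2 S (\<lambda>x. f x $ i $ j)" for f :: "_ \<Rightarrow> real^'n^'m"
  using in_L2_inner_const[of S f "axis i (axis j 1)"] by (simp add: inner_axis)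

lemma L2sq_mono: "(\<And>x. x \<in> S \<Longrightarrow> norm (f x) \<le> norm (g x)) \<Longrightarrow> L2sq S f \<le> L2sq S g"
  unfolding L2sq_def by (intro nn_integral_mono) (auto intro!: ennreal_leI power_mono)

lemma L2sq_null_mono:
  assumes "(\<lambda>k. L2sq S (f k)) \<longlonglongrightarrow> 0" "\<And>k x. norm (g k x) \<le> norm (f k x)"
  shows "(\<lambda>k. L2sq S (g k)) \<longlonglongrightarrow> 0"
  by (rule tendsto_sandwich[OF _ _ tendsto_const assms(1)]) (auto intro!: always_eventually L2sq_mono assms(2))

text \<open>A Hardy-type estimate: the weight is the derivative of \<open>g\<close>, and \<open>\<bar>g\<bar> \<le> \<delta> wall_weight \<delta>\<close>, so
  integrating \<open>g' w\<^sub>i\<^sup>2\<close> by parts (there is no boundary term for a field vanishing at the walls) and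
  absorbing gives the claim.\<close>

lemma wall_layer_estimate:
  fixes w :: "real^'n \<Rightarrow> real^'n"
  assumes w: "H10 v w G" and \<delta>: "\<delta> > 0"
  shows "(\<integral>x. wall_weight \<delta> (x $ v) * (w x $ i)\<^sup>2 \<partial>lebesgue_on cell)
     \<le> 4 * \<delta>\<^sup>2 * (\<integral>x. wall_weight \<delta> (x $ v) * (G x $ i $ v)\<^sup>2 \<partial>lebesgue_on cell)"
proof -
  define g where "g y = \<delta> * (exp ((1 / \<delta>) * y + (- 1 / \<delta>)) - exp ((- 1 / \<delta>) * y + 0))" for y
  have gs: "smooth g"
    unfolding g_def[abs_def]
    by (intro smooth_mult smooth_diff smooth_const smooth_affine[of exp]) (simp_all add: smooth_def Ck_exp)
  have g': "deriv g y = wall_weight \<delta> y" for y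
  proof (rule DERIV_imp_deriv)
    have "(g has_real_derivative \<delta> * (exp ((1 / \<delta>) * y + (- 1 / \<delta>)) * (1 / \<delta>)
        - exp ((- 1 / \<delta>) * y + 0) * (- 1 / \<delta>))) (at y)"
      unfolding g_def[abs_def] using \<delta> by (auto intro!: derivative_eq_intros)
    moreover have "\<delta> * (exp ((1 / \<delta>) * y + (- 1 / \<delta>)) * (1 / \<delta>)
        - exp ((- 1 / \<delta>) * y + 0) * (- 1 / \<delta>)) = wall_weight \<delta> y"
      using \<delta> by (simp add: wall_weight_def diff_divide_distrib distrib_left)
    ultimately show "(g has_real_derivative wall_weight \<delta> y) (at y)" by simp
  qed
  have g_le: "\<bar>g y\<bar> \<le> \<delta> * wall_weight \<delta> y" for y
    using \<delta> by (auto simp: g_def wall_weight_def abs_mult diff_divide_distrib abs_le_iff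
      intro!: mult_left_mono)
  have gc: "continuous_on UNIV (\<lambda>x::real^'n. g (x $ v))"
    by (intro continuous_on_vertical smooth_continuous_on gs)
  have qc: "continuous_on UNIV (\<lambda>x::real^'n. wall_weight \<delta> (x $ v))"
    by (intro continuous_on_vertical continuous_wall_weight)
  from w obtain \<phi> where \<phi>: "\<And>k::nat. space_test v (\<phi> k)"
    and lim1: "(\<lambda>k. L2sq cell (\<lambda>x. \<phi> k x - w x)) \<longlonglongrightarrow> 0"
    and lim2: "(\<lambda>k. L2sq cell (\<lambda>x. jacobian (\<phi> k) (at x) - G x)) \<longlonglongrightarrow> 0"
    unfolding H10_def by blast
  have \<phi>s: "smooth (\<phi> k)" for k using \<phi> by (simp add: space_test_def)
  have wi: "in_L2 cell (\<lambda>x. w x $ i)" and Gi: "in_L2 cell (\<lambda>x. G x $ i $ v)"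
    using w by (auto simp: H10_def in_L2_nth in_L2_nth_nth)
  define q where "q x = wall_weight \<delta> (x $ v)" for x :: "real^'n"
  define \<gamma> where "\<gamma> x = g (x $ v)" for x :: "real^'n"
  note qc = qc[folded q_def] and gc = gc[folded \<gamma>_def]
  have c\<phi>: "continuous_on UNIV (\<lambda>x. \<phi> k x $ i)" for k
    by (intro continuous_intros smooth_continuous_on \<phi>s)
  note cJ = continuous_jacobian_nth[OF \<phi>s]
  note L2 = in_L2_cell_mult_continuous[OF wi qc] in_L2_cell_mult_continuous[OF wi gc]
    in_L2_cell_mult_continuous[OF Gi gc] in_L2_cell_mult_continuous[OF Gi qc]
  have n1: "(\<lambda>k. L2sq cell (\<lambda>x. \<phi> k x $ i - w x $ i)) \<longlonglongrightarrow> 0"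
    using lim1 by (rule L2sq_null_mono) (simp only: Finite_Cartesian_Product.norm_nth_le flip: vector_minus_component)
  have n2: "(\<lambda>k. L2sq cell (\<lambda>x. jacobian (\<phi> k) (at x) $ i $ v - G x $ i $ v)) \<longlonglongrightarrow> 0"
    using lim2
    by (rule L2sq_null_mono)
      (simp only: order_trans[OF Finite_Cartesian_Product.norm_nth_le
          Finite_Cartesian_Product.norm_nth_le] flip: vector_minus_component)
  \<comment> \<open>The product of \<open>g\<close> and a component of \<open>w\<close> is not an
    admissible test function, so that component is replaced by the approximant
    \<open>\<phi> k\<close> there, while \<open>w\<close> stays in the other factor. Each term is
    then linear in \<open>\<phi> k\<close>, and strong convergence is enough for the limit.\<close>
  have eq: "L2_inner cell (\<lambda>x. \<phi> k x $ i) (\<lambda>x. q x *\<^sub>R w x $ i)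
     + L2_inner cell (\<lambda>x. jacobian (\<phi> k) (at x) $ i $ v) (\<lambda>x. \<gamma> x *\<^sub>R w x $ i)
     = - L2_inner cell (\<lambda>x. \<phi> k x $ i) (\<lambda>x. \<gamma> x *\<^sub>R G x $ i $ v)" for k
  proof -
    have "(\<integral>x. w x $ i * frechet_derivative (\<lambda>x. g (x $ v) * \<phi> k x $ i) (at x) (axis v 1) \<partial>lebesgue_on cell)
      = - (\<integral>x. G x $ i $ v * (g (x $ v) * \<phi> k x $ i) \<partial>lebesgue_on cell)"
      using w space_test_vertical_mult[OF \<phi> gs] unfolding H10_def weak_gradient_def by blast
    also have "(\<integral>x. w x $ i * frechet_derivative (\<lambda>x. g (x $ v) * \<phi> k x $ i) (at x) (axis v 1) \<partial>lebesgue_on cell)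
      = (\<integral>x. \<phi> k x $ i \<bullet> (q x *\<^sub>R w x $ i)
          + jacobian (\<phi> k) (at x) $ i $ v \<bullet> (\<gamma> x *\<^sub>R w x $ i) \<partial>lebesgue_on cell)"
      unfolding frechet_derivative_vertical_mult[OF \<phi>s gs] g' q_def \<gamma>_def
      by (simp add: algebra_simps)
    also have "\<dots> = L2_inner cell (\<lambda>x. \<phi> k x $ i) (\<lambda>x. q x *\<^sub>R w x $ i)
     + L2_inner cell (\<lambda>x. jacobian (\<phi> k) (at x) $ i $ v) (\<lambda>x. \<gamma> x *\<^sub>R w x $ i)"
      unfolding L2_inner_def
      by (intro Bochner_Integration.integral_add integrable_inner_L2 L2 in_L2_cell_continuous c\<phi> cJ)
    finally show ?thesis
      by (simp add: L2_inner_def \<gamma>_def ac_simps)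
  qed
  have l1: "(\<lambda>k. L2_inner cell (\<lambda>x. \<phi> k x $ i) (\<lambda>x. q x *\<^sub>R w x $ i)
     + L2_inner cell (\<lambda>x. jacobian (\<phi> k) (at x) $ i $ v) (\<lambda>x. \<gamma> x *\<^sub>R w x $ i))
    \<longlonglongrightarrow> L2_inner cell (\<lambda>x. w x $ i) (\<lambda>x. q x *\<^sub>R w x $ i)
     + L2_inner cell (\<lambda>x. G x $ i $ v) (\<lambda>x. \<gamma> x *\<^sub>R w x $ i)"
    by (intro tendsto_add L2_strong_convergence_inner measurable_continuous_cell c\<phi> cJ wi Gi L2 n1 n2)
  have l2: "(\<lambda>k. - L2_inner cell (\<lambda>x. \<phi> k x $ i) (\<lambda>x. \<gamma> x *\<^sub>R G x $ i $ v))
    \<longlonglongrightarrow> - L2_inner cell (\<lambda>x. w x $ i) (\<lambda>x. \<gamma> x *\<^sub>R G x $ i $ v)"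
    by (intro tendsto_minus L2_strong_convergence_inner measurable_continuous_cell c\<phi> cJ wi Gi L2 n1 n2)
  have "L2_inner cell (\<lambda>x. w x $ i) (\<lambda>x. q x *\<^sub>R w x $ i)
     + L2_inner cell (\<lambda>x. G x $ i $ v) (\<lambda>x. \<gamma> x *\<^sub>R w x $ i)
     = - L2_inner cell (\<lambda>x. w x $ i) (\<lambda>x. \<gamma> x *\<^sub>R G x $ i $ v)"
    using l1 l2 unfolding eq by (rule LIMSEQ_unique)
  \<comment> \<open>In the limit the derivative falling on the approximant and the weak gradient of
    \<open>w\<close> give the same integral, whence the factor 2.\<close>
  then have key: "(\<integral>x. q x * (w x $ i)\<^sup>2 \<partial>lebesgue_on cell)
      = (\<integral>x. - 2 * (w x $ i * (\<gamma> x * G x $ i $ v)) \<partial>lebesgue_on cell)"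
    by (subst integral_mult_right_zero) (simp add: L2_inner_def power2_eq_square algebra_simps)
  have iw: "integrable (lebesgue_on cell) (\<lambda>x. q x * (w x $ i)\<^sup>2)"
    using integrable_inner_L2[OF wi L2(1)] by (simp add: power2_eq_square algebra_simps)
  have iG: "integrable (lebesgue_on cell) (\<lambda>x. q x * (G x $ i $ v)\<^sup>2)"
    using integrable_inner_L2[OF Gi L2(4)] by (simp add: power2_eq_square algebra_simps)
  have iwG: "integrable (lebesgue_on cell) (\<lambda>x. w x $ i * (\<gamma> x * G x $ i $ v))"
    using integrable_inner_L2[OF wi L2(3)] by simp
  \<comment> \<open>Young's inequality 2 a b \<le> a^2/2 + 2 b^2 with b = \<delta> |G|. The first
    term is absorbed into the left side, which doubles the constant 2 to 4.\<close>
  have pt: "- 2 * (w x $ i * (\<gamma> x * G x $ i $ v)) \<le> q x * (w x $ i)\<^sup>2 / 2 + 2 * \<delta>\<^sup>2 * (q x * (G x $ i $ v)\<^sup>2)" for x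
  proof -
    let ?a = "\<bar>w x $ i\<bar>" and ?b = "\<bar>G x $ i $ v\<bar>"
    have q: "q x > 0" unfolding q_def by (rule wall_weight_pos)
    have "- 2 * (w x $ i * (\<gamma> x * G x $ i $ v)) \<le> 2 * \<bar>\<gamma> x\<bar> * (?a * ?b)"
      using abs_ge_minus_self[of "w x $ i * (\<gamma> x * G x $ i $ v)"] by (simp add: abs_mult ac_simps)
    also have "\<dots> \<le> 2 * (\<delta> * q x) * (?a * ?b)"
      using g_le[of "x $ v"] by (intro mult_right_mono) (auto simp: \<gamma>_def q_def)
    also have "\<dots> = q x * (2 * ?a * (\<delta> * ?b))" by simp
    also have "\<dots> \<le> q x * (?a\<^sup>2 / 2 + 2 * (\<delta> * ?b)\<^sup>2)"
    proof (rule mult_left_mono)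
      have "0 \<le> (?a - 2 * (\<delta> * ?b))\<^sup>2" by simp
      then show "2 * ?a * (\<delta> * ?b) \<le> ?a\<^sup>2 / 2 + 2 * (\<delta> * ?b)\<^sup>2"
        by (simp add: power2_diff power_mult_distrib)
    qed (use q in simp)
    also have "\<dots> = q x * (w x $ i)\<^sup>2 / 2 + 2 * \<delta>\<^sup>2 * (q x * (G x $ i $ v)\<^sup>2)"
      by (simp add: algebra_simps power_mult_distrib)
    finally show ?thesis .
  qed
  have "(\<integral>x. q x * (w x $ i)\<^sup>2 \<partial>lebesgue_on cell)
     \<le> (\<integral>x. q x * (w x $ i)\<^sup>2 / 2 + 2 * \<delta>\<^sup>2 * (q x * (G x $ i $ v)\<^sup>2) \<partial>lebesgue_on cell)"
    unfolding key
    by (intro integral_mono pt Bochner_Integration.integrable_add integrable_divide integrable_mult_right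
        iw iG iwG) 
  also have "\<dots> = (\<integral>x. q x * (w x $ i)\<^sup>2 \<partial>lebesgue_on cell) / 2
      + 2 * \<delta>\<^sup>2 * (\<integral>x. q x * (G x $ i $ v)\<^sup>2 \<partial>lebesgue_on cell)"
    using iw iG by (subst Bochner_Integration.integral_add) auto
  finally show ?thesis unfolding q_def by simp
qed

section \<open>Local integrability on the half-line\<close>

lemma bounded_continuous_on_bounded:
  fixes m :: "'a::euclidean_space \<Rightarrow> 'b::real_normed_vector"
  assumes "bounded S" "continuous_on UNIV m"
  obtains B where "\<forall>x\<in>S. norm (m x) \<le> B"
proof -
  have "compact (m ` closure S)"
    using assms by (intro compact_continuous_image) (auto intro: continuous_on_subset)
  then obtain B where "\<forall>x\<in>closure S. norm (m x) \<le> B"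
    using compact_imp_bounded[of "m ` closure S"] by (force simp: bounded_iff)
  then have "\<forall>x\<in>S. norm (m x) \<le> B"
    using closure_subset by blast
  then show ?thesis by (rule that)
qed

lemma in_L2_mult_continuous:
  assumes "bounded S" "S \<in> sets lebesgue" "in_L2 S f" "continuous_on UNIV m"
  shows "in_L2 S (\<lambda>x. m x *\<^sub>R f x)"
proof -
  obtain B where "\<forall>x\<in>S. norm (m x) \<le> B"
    using assms by (rule_tac bounded_continuous_on_bounded)
  moreover have "m \<in> borel_measurable (lebesgue_on S)"
    using assms by (intro continuous_imp_measurable_on_sets_lebesgue) (auto intro: continuous_on_subset)
  ultimately show ?thesis
    by (intro in_L2_mult_bounded[OF assms(3)]) auto
qed

lemma integrable_lebesgue_on_superset:
  fixes h :: "'a::euclidean_space \<Rightarrow> real"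
  assumes h: "integrable (lebesgue_on S) h" and S: "S \<in> sets lebesgue" and T: "T \<in> sets lebesgue"
    and "S \<subseteq> T" and zero: "\<And>x. x \<in> T - S \<Longrightarrow> h x = 0"
  shows "integrable (lebesgue_on T) h"
proof -
  have "(\<lambda>x. indicat_real T x *\<^sub>R h x) = (\<lambda>x. indicat_real S x *\<^sub>R h x)"
    using zero \<open>S \<subseteq> T\<close> by (intro ext) (auto simp: indicator_def)
  then show ?thesis
    using h S T by (simp add: integrable_restrict_space del: real_scaleR_def)
qed

text \<open>Integrability up to time 0 is included, since averages near the initial time are
  taken.\<close>

definition locally_integrable :: "(real \<Rightarrow> real) \<Rightarrow> bool" where
  "locally_integrable k \<longleftrightarrow> (\<forall>T>0. integrable (lebesgue_on {0<..<T}) k)"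

lemma locally_integrable_continuous:
  assumes "continuous_on {0..} k"
  shows "locally_integrable k"
  unfolding locally_integrable_def
proof (intro allI impI)
  fix T :: real assume "T > 0"
  have "compact (k ` {0..T})"
    by (intro compact_continuous_image continuous_on_subset[OF assms]) auto
  then obtain B where "\<forall>x\<in>{0..T}. norm (k x) \<le> B"
    using compact_imp_bounded[of "k ` {0..T}"] by (force simp: bounded_iff)
  moreover have "k \<in> borel_measurable (lebesgue_on {0<..<T})"
    by (intro continuous_imp_measurable_on_sets_lebesgue continuous_on_subset[OF assms]) auto
  moreover have "{0<..<T} \<in> lmeasurable"
    by (intro bounded_set_imp_lmeasurable) auto
  ultimately show "integrable (lebesgue_on {0<..<T}) k"
    by (intro finite_measure.integrable_const_bound[of _ _ B] finite_measure_lebesgue_on) (auto intro!: AE_I2)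
qed

lemma integrable_mult_locally_integrable:
  assumes k: "locally_integrable k" and \<theta>: "continuous_on UNIV \<theta>" and supp: "\<And>t. b < t \<Longrightarrow> \<theta> t = 0"
  shows "integrable (lebesgue_on {0<..}) (\<lambda>t. \<theta> t * k t)"
proof -
  \<comment> \<open>The maximum keeps \<open>T\<close> positive even when \<open>b\<close> is
    negative.\<close>
  define T where "T = max 1 (b + 1)"
  have T: "T > 0" "b < T" by (auto simp: T_def)
  have ki: "integrable (lebesgue_on {0<..<T}) k"
    using k T by (simp add: locally_integrable_def)
  obtain B where B: "\<forall>x\<in>{0<..<T}. norm (\<theta> x) \<le> B"
    by (rule bounded_continuous_on_bounded[OF bounded_box[of 0 T, unfolded box_real] \<theta>])
  have "\<theta> \<in> borel_measurable (lebesgue_on {0<..<T})"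
    using \<theta> by (intro continuous_imp_measurable_on_sets_lebesgue) (auto intro: continuous_on_subset)
  then have "(\<lambda>t. \<theta> t * k t) \<in> borel_measurable (lebesgue_on {0<..<T})"
    using borel_measurable_integrable[OF ki] by (rule borel_measurable_times)
  then have "integrable (lebesgue_on {0<..<T}) (\<lambda>t. \<theta> t * k t)"
    by (rule Bochner_Integration.integrable_bound[OF integrable_mult_right[OF ki, of B]])
      (use B in \<open>auto intro!: AE_I2 mult_right_mono simp: abs_mult intro: order_trans[OF _ abs_ge_self]\<close>)
  then show ?thesis
    by (rule integrable_lebesgue_on_superset) (use T supp in auto)
qed

section \<open>Shear test fields\<close>

lemma jacobian_shear:
  fixes f :: "real \<Rightarrow> real"
  assumes "smooth f"
  shows "jacobian (\<lambda>y::real^'n. (c * f (y $ v)) *\<^sub>R axis i (1::real)) (at x)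
    = axis i (axis v (c * deriv f (x $ v)))"
proof -
  have "((\<lambda>y::real^'n. (c * f (y $ v)) *\<^sub>R axis i (1::real)) has_derivative
      (\<lambda>h. (c * (deriv f (x $ v) * h $ v)) *\<^sub>R axis i 1)) (at x)"
    by (intro has_derivative_scaleR_left has_derivative_mult_right has_derivative_vertical assms)
  from frechet_derivative_at[OF this]
  have "frechet_derivative (\<lambda>y::real^'n. (c * f (y $ v)) *\<^sub>R axis i (1::real)) (at x)
    = (\<lambda>h. (c * (deriv f (x $ v) * h $ v)) *\<^sub>R axis i 1)" by simp
  then show ?thesis
    by (simp add: vec_eq_iff jacobian_nth axis_def)
qed

lemma axis_axis_mult_vector:
  fixes x :: "real^'n"
  shows "axis i (axis v c) *v x = axis i (c * x $ v)"
proof -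
  have axis: "axis i y $ j = (if j = i then y else 0)" for y :: "'z::zero" and j
    by (simp add: axis_def)
  have "(axis i (axis v c) *v x) $ j = axis i (c * x $ v) $ j" for j
    unfolding matrix_vector_mul_component axis by (simp add: inner_axis')
  then show ?thesis by (simp add: vec_eq_iff)
qed

text \<open>A horizontal shear that varies only vertically has a single Jacobian entry, off the
  diagonal. It is therefore divergence free, and the pressure disappears from the momentum
  balance.\<close>

lemma trace_axis_axis: "i \<noteq> v \<Longrightarrow> trace (axis i (axis v c) :: real^'n^'n) = 0"
  by (auto simp: trace_def axis_def intro!: sum.neutral)

lemma spacetime_test_shear:
  fixes i v :: "'n::finite"
  assumes \<eta>: "smooth \<eta>" "\<And>t. \<eta> t \<noteq> 0 \<Longrightarrow> a \<le> t \<and> t \<le> b" "a > 0"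
    and f: "smooth f" "\<And>y. f y \<noteq> 0 \<Longrightarrow> \<delta> \<le> y \<and> y \<le> 1 - \<delta>" "\<delta> > 0"
  shows "spacetime_test v (\<lambda>(t, x::real^'n). (\<eta> t * f (x $ v)) *\<^sub>R axis i (1::real))"
  unfolding spacetime_test_def
proof (intro conjI)
  have 1: "smooth (\<lambda>p :: real \<times> (real^'n). \<eta> (fst p))"
    by (rule smooth_compose_linear[OF bounded_linear_fst \<eta>(1)])
  have "bounded_linear (\<lambda>p :: real \<times> (real^'n). snd p $ v)"
    by (rule bounded_linear_compose[OF bounded_linear_vec_nth bounded_linear_snd])
  then have 2: "smooth (\<lambda>p :: real \<times> (real^'n). f (snd p $ v))"
    using f(1) by (rule smooth_compose_linear)
  show "smooth (\<lambda>(t, x::real^'n). (\<eta> t * f (x $ v)) *\<^sub>R axis i (1::real))"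
    unfolding case_prod_unfold by (intro smooth_scaleR smooth_mult smooth_const 1 2)
  show "\<forall>t. horizontally_periodic v (\<lambda>x. case (t, x) of (t, x) \<Rightarrow> (\<eta> t * f (x $ v)) *\<^sub>R axis i (1::real))"
    by (auto simp: horizontally_periodic_def axis_def)
  show "\<exists>a>0. \<exists>b. \<exists>\<delta>>0. \<forall>t (x::real^'n).
      (case (t, x) of (t, x) \<Rightarrow> (\<eta> t * f (x $ v)) *\<^sub>R axis i (1::real)) \<noteq> 0 \<longrightarrow>
        a \<le> t \<and> t \<le> b \<and> \<delta> \<le> x $ v \<and> x $ v \<le> 1 - \<delta>"
    using \<eta>(2,3) f(2,3)
    by (intro exI[of _ a] exI[of _ b] exI[of _ \<delta>] conjI) auto
qed

section \<open>Leray--Hopf solutions tested with a shear flow\<close>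

text \<open>The equation for \<delta> makes 8 A B exp(2) \<delta>, the factor with which convection
  meets the dissipation, equal to \<nu>/2. The bound on 2 \<delta> lets the slab of width 2 \<delta>
  have measure at most 4 \<delta>.\<close>

locale channel_solution =
  fixes v i :: "'n::finite" and \<nu> A B \<delta> :: real
    and u :: "real \<Rightarrow> real^'n \<Rightarrow> real^'n" and G :: "real \<Rightarrow> real^'n \<Rightarrow> real^'n^'n"
  assumes iv: "i \<noteq> v" and \<nu>: "\<nu> > 0" and A: "A > 0"
    and B: "B > 0" "\<And>x. deriv step x \<le> B"
    and \<delta>: "16 * A * B * exp 2 * \<delta> = \<nu>" "2 * \<delta> \<le> 1"
    and energy_class: "energy_class v u G"
    and weak_NSE: "weak_NSE v \<nu> u G"
    and energy_inequality: "energy_inequality \<nu> u G"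
begin

definition shear :: "real^'n \<Rightarrow> real^'n" where
  "shear x = wall_cutoff \<delta> (x $ v) *\<^sub>R axis i 1"

definition momentum :: "real \<Rightarrow> real" where
  "momentum t = L2_inner cell (u t) shear"

definition energy :: "real \<Rightarrow> real" where
  "energy t = L2_inner cell (u t) (u t) / 2"

definition dissipation :: "real \<Rightarrow> real" where
  "dissipation t = L2_inner cell (G t) (G t)"

text \<open>Formally the time derivative of \<open>momentum\<close>: convective minus viscous
  transport of horizontal momentum through the layers.\<close>

definition flux :: "(real^'n \<Rightarrow> real^'n) \<Rightarrow> (real^'n \<Rightarrow> real^'n^'n) \<Rightarrow> real" where
  "flux w H = (\<integral>x. deriv (wall_cutoff \<delta>) (x $ v) * (w x $ v * w x $ i - \<nu> * H x $ i $ v) \<partial>lebesgue_on cell)"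

text \<open>The viscous remainder \<nu> A^2/2 (2B/\<delta>)^2 4\<delta> with the value of \<delta>
  inserted; \<nu> cancels.\<close>

definition growth_rate :: real where
  "growth_rate = 128 * B ^ 3 * exp 2 * A ^ 3"

lemma \<delta>_pos: "\<delta> > 0"
proof -
  have "0 < (16 * A * B * exp 2) * \<delta>" using \<nu> \<delta> by simp
  then show ?thesis
    by (rule zero_less_mult_pos) (use A B in simp)
qed

lemma growth_rate_pos: "growth_rate > 0"
  using A B by (simp add: growth_rate_def)

lemma u_L2: "t \<ge> 0 \<Longrightarrow> in_L2 cell (u t)"
  and u_weakly_continuous: "in_L2 cell w \<Longrightarrow> continuous_on {0..} (\<lambda>t. L2_inner cell (u t) w)"
  and u_L2_spacetime: "T > 0 \<Longrightarrow> in_L2 ({0<..<T} \<times> cell) (\<lambda>(t, x). u t x)"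
  and G_L2_spacetime: "T > 0 \<Longrightarrow> in_L2 ({0<..<T} \<times> cell) (\<lambda>(t, x). G t x)"
  and AE_H10: "AE t in lebesgue. 0 < t \<longrightarrow> H10 v (u t) (G t)"
  using energy_class unfolding energy_class_def by blast+

lemma shear_L2: "in_L2 cell shear"
  unfolding shear_def[abs_def]
  by (intro in_L2_cell_continuous continuous_on_scaleR continuous_on_vertical smooth_continuous_on
      smooth_wall_cutoff continuous_on_const)

lemma continuous_momentum: "continuous_on {0..} momentum"
  unfolding momentum_def[abs_def] by (intro u_weakly_continuous shear_L2)

lemma locally_integrable_energy: "locally_integrable energy"
  unfolding locally_integrable_def
proof (intro allI impI)
  fix T :: real assume "T > 0"
  from integrable_inner_L2[OF u_L2_spacetime u_L2_spacetime, OF this this]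
  have "integrable (lebesgue_on ({0<..<T} \<times> cell)) (\<lambda>(t, x). u t x \<bullet> u t x)"
    by (simp add: case_prod_unfold)
  from integrable_lebesgue_on_fst[OF _ cell_borel this]
  show "integrable (lebesgue_on {0<..<T}) energy"
    by (simp add: energy_def[abs_def] L2_inner_def)
qed

lemma locally_integrable_dissipation: "locally_integrable dissipation"
  unfolding locally_integrable_def
proof (intro allI impI)
  fix T :: real assume "T > 0"
  from integrable_inner_L2[OF G_L2_spacetime G_L2_spacetime, OF this this]
  have "integrable (lebesgue_on ({0<..<T} \<times> cell)) (\<lambda>(t, x). G t x \<bullet> G t x)"
    by (simp add: case_prod_unfold)
  from integrable_lebesgue_on_fst[OF _ cell_borel this]
  show "integrable (lebesgue_on {0<..<T}) dissipation"
    by (simp add: dissipation_def[abs_def] L2_inner_def)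
qed

lemma continuous_deriv_wall_cutoff: "continuous_on UNIV (\<lambda>x::real^'n. deriv (wall_cutoff \<delta>) (x $ v))"
  by (intro continuous_on_vertical smooth_continuous_on smooth_deriv smooth_wall_cutoff)

lemma integrable_flux_convection:
  assumes "H10 v w H"
  shows "integrable (lebesgue_on cell) (\<lambda>x. deriv (wall_cutoff \<delta>) (x $ v) * (w x $ v * w x $ i))"
proof -
  have L2: "in_L2 cell (\<lambda>x. w x $ j)" for j
    using assms by (auto simp: H10_def in_L2_nth)
  show ?thesis
    using integrable_inner_L2[OF in_L2_cell_mult_continuous[OF L2 continuous_deriv_wall_cutoff] L2, of v i]
    by (simp add: ac_simps)
qed

lemma integrable_flux_viscous:
  assumes "H10 v w H"
  shows "integrable (lebesgue_on cell) (\<lambda>x. deriv (wall_cutoff \<delta>) (x $ v) * H x $ i $ v)"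
proof -
  have "in_L2 cell (\<lambda>x. H x $ i $ v)"
    using assms by (auto simp: H10_def in_L2_nth_nth)
  from integrable_inner_L2[OF this in_L2_cell_continuous[OF continuous_deriv_wall_cutoff]]
  show ?thesis by (simp add: ac_simps)
qed

text \<open>The width \<open>\<delta>\<close> is chosen so that the convective part is absorbed by half of the dissipation.\<close>

lemma flux_bound:
  assumes "H10 v w H"
  shows "- A * flux w H \<le> \<nu> * L2_inner cell H H + growth_rate"
proof -
  note [simp] = \<delta>_pos less_imp_neq[OF \<delta>_pos, symmetric]
  define q where "q x = wall_weight \<delta> (x $ v)" for x :: "real^'n"
  have qc: "continuous_on UNIV q"
    unfolding q_def by (intro continuous_on_vertical continuous_wall_weight)
  have q0: "q x > 0" for x unfolding q_def by (rule wall_weight_pos)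
  define J where "J j = (\<integral>x. (H x $ j $ v)\<^sup>2 \<partial>lebesgue_on cell)" for j
  have wL2: "in_L2 cell (\<lambda>x. w x $ j)" for j
    using assms by (auto simp: H10_def in_L2_nth)
  have HL2: "in_L2 cell (\<lambda>x. H x $ j $ v)" for j
    using assms by (auto simp: H10_def in_L2_nth_nth)
  have iw: "integrable (lebesgue_on cell) (\<lambda>x. q x * (w x $ j)\<^sup>2)" for j
    using integrable_inner_L2[OF in_L2_cell_mult_continuous[OF wL2 qc] wL2, of j j]
    by (simp add: power2_eq_square ac_simps)
  have iqH: "integrable (lebesgue_on cell) (\<lambda>x. q x * (H x $ j $ v)\<^sup>2)" for j
    using integrable_inner_L2[OF in_L2_cell_mult_continuous[OF HL2 qc] HL2, of j j]
    by (simp add: power2_eq_square ac_simps)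
  have iH: "integrable (lebesgue_on cell) (\<lambda>x. (H x $ j $ v)\<^sup>2)" for j
    using integrable_inner_L2[OF HL2 HL2, of j j] by (simp add: power2_eq_square)
  have J: "J j \<le> L2_inner cell H H" for j
    unfolding J_def L2_inner_def
  proof (rule integral_mono[OF iH])
    show "integrable (lebesgue_on cell) (\<lambda>x. H x \<bullet> H x)"
      using assms by (auto simp: H10_def in_L2_iff)
    show "(H x $ j $ v)\<^sup>2 \<le> H x \<bullet> H x" for x
    proof -
      have "\<bar>H x $ j $ v\<bar> \<le> norm (H x)"
        using order_trans[OF Finite_Cartesian_Product.norm_nth_le[of "H x $ j" v]
            Finite_Cartesian_Product.norm_nth_le[of "H x" j]] by simp
      then have "\<bar>H x $ j $ v\<bar>\<^sup>2 \<le> (norm (H x))\<^sup>2" by (intro power_mono) auto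
      then show ?thesis by (simp add: power2_norm_eq_inner)
    qed
  qed
  \<comment> \<open>The constant is the Hardy constant 4 times the maximum 2 of the weight on the
    cell. Both velocity components in the convective term obey it, as each vanishes at the
    walls.\<close>
  have layer: "(\<integral>x. q x * (w x $ j)\<^sup>2 \<partial>lebesgue_on cell) \<le> 8 * \<delta>\<^sup>2 * L2_inner cell H H" for j
  proof -
    have "(\<integral>x. q x * (w x $ j)\<^sup>2 \<partial>lebesgue_on cell)
        \<le> 4 * \<delta>\<^sup>2 * (\<integral>x. q x * (H x $ j $ v)\<^sup>2 \<partial>lebesgue_on cell)"
      unfolding q_def by (rule wall_layer_estimate[OF assms \<delta>_pos])
    also have "(\<integral>x. q x * (H x $ j $ v)\<^sup>2 \<partial>lebesgue_on cell) \<le> (\<integral>x. 2 * (H x $ j $ v)\<^sup>2 \<partial>lebesgue_on cell)"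
    proof (rule integral_mono[OF iqH])
      fix x :: "real^'n" assume "x \<in> space (lebesgue_on cell)"
      then have "0 \<le> x $ v" "x $ v \<le> 1" by (auto simp: cell_def less_imp_le)
      then show "q x * (H x $ j $ v)\<^sup>2 \<le> 2 * (H x $ j $ v)\<^sup>2"
        unfolding q_def by (intro mult_right_mono wall_weight_le) auto
    qed (use iH in auto)
    also have "\<dots> \<le> 2 * L2_inner cell H H" using J[of j] by (simp add: J_def)
    finally show ?thesis by (simp add: mult_left_mono)
  qed
  define C where "C = B * exp 2 / \<delta>"
  define f' where "f' x = deriv (wall_cutoff \<delta>) (x $ v)" for x :: "real^'n"
  define S where "S = wall_slab v (2 * \<delta>)"
  have iS: "integrable (lebesgue_on cell) (indicat_real S)"
  proof -
    have "S \<subseteq> cell" by (auto simp: S_def wall_slab_def)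
    then have "S \<in> sets (lebesgue_on cell)"
      using cell_sets_lebesgue fmeasurableD[OF wall_slab_lmeasurable[of v "2 * \<delta>"]]
      unfolding S_def by (subst sets_restrict_space_iff) auto
    then show ?thesis
      using finite_measure.emeasure_finite[OF finite_measure_lebesgue_on[OF cell_lmeasurable]]
      by (intro integrable_real_indicator) (auto simp: top.not_eq_extremum)
  qed
  have mS: "(\<integral>x. indicat_real S x \<partial>lebesgue_on cell) \<le> 4 * \<delta>"
  proof -
    have "(\<integral>x. indicat_real S x \<partial>lebesgue_on cell) = (\<integral>x. indicat_real cell x *\<^sub>R indicat_real S x \<partial>lebesgue)"
      by (subst integral_restrict_space) (use cell_sets_lebesgue in auto)
    also have "\<dots> = (\<integral>x. indicat_real S x \<partial>lebesgue)"
      by (intro Bochner_Integration.integral_cong) (auto simp: S_def wall_slab_def indicator_def)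
    also have "\<dots> = measure lebesgue S" by simp
    also have "\<dots> \<le> 4 * \<delta>"
      using measure_wall_slab[of "2 * \<delta>" v] \<delta>(2) less_imp_le[OF \<delta>_pos] by (simp add: S_def)
    finally show ?thesis .
  qed
  \<comment> \<open>The two bounds for the slope are used separately: the weight for convection,
    where the layer estimate applies, and the slab indicator for the viscous term, where Young's
    inequality leaves half of \<nu> times the squared gradient entry.\<close>
  have pt: "- A * (f' x * (w x $ v * w x $ i - \<nu> * H x $ i $ v))
     \<le> A * C / 2 * (q x * (w x $ v)\<^sup>2) + A * C / 2 * (q x * (w x $ i)\<^sup>2)
       + \<nu> / 2 * (H x $ i $ v)\<^sup>2 + \<nu> * A\<^sup>2 / 2 * (2 * B / \<delta>)\<^sup>2 * indicat_real S x"
    if x: "x \<in> cell" for x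
  proof -
    have 1: "\<bar>f' x\<bar> \<le> C * q x"
      unfolding f'_def C_def q_def by (rule deriv_wall_cutoff_le_weight[OF \<delta>_pos B(2)])
    have 2: "(f' x)\<^sup>2 \<le> (2 * B / \<delta>)\<^sup>2 * indicat_real S x"
      unfolding f'_def S_def by (rule deriv_wall_cutoff_sq_le_indicator[OF \<delta>_pos B(2) x])
    have "\<bar>w x $ v * w x $ i\<bar> \<le> ((w x $ v)\<^sup>2 + (w x $ i)\<^sup>2) / 2"
      using sum_squares_bound[of "\<bar>w x $ v\<bar>" "\<bar>w x $ i\<bar>"] by (simp add: abs_mult)
    then have "\<bar>f' x\<bar> * \<bar>w x $ v * w x $ i\<bar> \<le> (C * q x) * (((w x $ v)\<^sup>2 + (w x $ i)\<^sup>2) / 2)"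
      using 1 by (intro mult_mono) auto
    then have "- (f' x * (w x $ v * w x $ i)) \<le> (C * q x) * (((w x $ v)\<^sup>2 + (w x $ i)\<^sup>2) / 2)"
      using abs_ge_minus_self[of "f' x * (w x $ v * w x $ i)"] unfolding abs_mult by linarith
    then have 3: "A * - (f' x * (w x $ v * w x $ i)) \<le> A * ((C * q x) * (((w x $ v)\<^sup>2 + (w x $ i)\<^sup>2) / 2))"
      using A by (intro mult_left_mono) auto
    have "0 \<le> (A * f' x - H x $ i $ v)\<^sup>2" by simp
    then have "A * f' x * H x $ i $ v \<le> (H x $ i $ v)\<^sup>2 / 2 + A\<^sup>2 / 2 * (f' x)\<^sup>2"
      by (simp add: power2_diff power_mult_distrib)
    also have "\<dots> \<le> (H x $ i $ v)\<^sup>2 / 2 + A\<^sup>2 / 2 * ((2 * B / \<delta>)\<^sup>2 * indicat_real S x)"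
      using 2 by (intro add_left_mono mult_left_mono) auto
    finally have "\<nu> * (A * f' x * H x $ i $ v)
       \<le> \<nu> * ((H x $ i $ v)\<^sup>2 / 2 + A\<^sup>2 / 2 * ((2 * B / \<delta>)\<^sup>2 * indicat_real S x))"
      using \<nu> by (intro mult_left_mono) auto
    with 3 show ?thesis
      by (simp add: algebra_simps add_divide_distrib)
  qed
  have linear: "(\<integral>x. a * f x + b * g x + c * h x + d * k x \<partial>M)
      = a * (\<integral>x. f x \<partial>M) + b * (\<integral>x. g x \<partial>M) + c * (\<integral>x. h x \<partial>M) + d * (\<integral>x. k x \<partial>M)"
    if "integrable M f" "integrable M g" "integrable M h" "integrable M k"
    for a b c d :: real and f g h k and M :: "(real^'n) measure"
    using that by simp
  have "- A * flux w H = (\<integral>x. - A * (f' x * (w x $ v * w x $ i - \<nu> * H x $ i $ v)) \<partial>lebesgue_on cell)"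
    by (simp add: flux_def f'_def)
  also have "\<dots> \<le> (\<integral>x. A * C / 2 * (q x * (w x $ v)\<^sup>2) + A * C / 2 * (q x * (w x $ i)\<^sup>2)
       + \<nu> / 2 * (H x $ i $ v)\<^sup>2 + \<nu> * A\<^sup>2 / 2 * (2 * B / \<delta>)\<^sup>2 * indicat_real S x \<partial>lebesgue_on cell)"
  proof (rule integral_mono)
    have "integrable (lebesgue_on cell) (\<lambda>x. f' x * (w x $ v * w x $ i) - \<nu> * (f' x * H x $ i $ v))"
      unfolding f'_def
      by (intro Bochner_Integration.integrable_diff integrable_mult_right
          integrable_flux_convection[OF assms] integrable_flux_viscous[OF assms])
    then show "integrable (lebesgue_on cell) (\<lambda>x. - A * (f' x * (w x $ v * w x $ i - \<nu> * H x $ i $ v)))"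
      by (intro integrable_mult_right) (simp add: algebra_simps)
  qed (use pt in \<open>auto intro!: Bochner_Integration.integrable_add integrable_mult_right iw iH iS\<close>)
  also have "\<dots> = A * C / 2 * (\<integral>x. q x * (w x $ v)\<^sup>2 \<partial>lebesgue_on cell)
      + A * C / 2 * (\<integral>x. q x * (w x $ i)\<^sup>2 \<partial>lebesgue_on cell)
      + \<nu> / 2 * J i + \<nu> * A\<^sup>2 / 2 * (2 * B / \<delta>)\<^sup>2 * (\<integral>x. indicat_real S x \<partial>lebesgue_on cell)"
    unfolding J_def by (rule linear[OF iw iw iH iS])
  also have "\<dots> \<le> A * C / 2 * (8 * \<delta>\<^sup>2 * L2_inner cell H H) + A * C / 2 * (8 * \<delta>\<^sup>2 * L2_inner cell H H)
      + \<nu> / 2 * L2_inner cell H H + \<nu> * A\<^sup>2 / 2 * (2 * B / \<delta>)\<^sup>2 * (4 * \<delta>)"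
    using A B(1) \<nu> by (intro add_mono mult_left_mono layer J mS)
      (auto simp: C_def intro!: divide_nonneg_pos)
  also have "\<dots> = (A * C * 8 * \<delta>\<^sup>2 + \<nu> / 2) * L2_inner cell H H + \<nu> * A\<^sup>2 / 2 * (2 * B / \<delta>)\<^sup>2 * (4 * \<delta>)"
    by (simp add: algebra_simps)
  \<comment> \<open>Here the constant 16 in the choice of \<delta> is fixed; with the \<nu>/2 from
    the viscous term the dissipation is used up exactly.\<close>
  also have "A * C * 8 * \<delta>\<^sup>2 = \<nu> / 2"
    unfolding C_def \<delta>(1)[symmetric] by (simp add: field_simps power2_eq_square)
  also have "\<nu> * A\<^sup>2 / 2 * (2 * B / \<delta>)\<^sup>2 * (4 * \<delta>) = growth_rate"
    unfolding growth_rate_def \<delta>(1)[symmetric]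
    by (simp add: field_simps power2_eq_square power3_eq_cube)
  finally show ?thesis by simp
qed

text \<open>The distributional form of - A momentum' \<le> \<nu> dissipation +
  \<open>growth_rate\<close>, obtained by testing with \<open>\<eta> t\<close> times the shear. The
  right side is shaped to cancel against the energy inequality.\<close>

lemma momentum_inequality:
  assumes \<eta>: "smooth \<eta>" "\<And>t. 0 \<le> \<eta> t" and supp: "\<And>t. \<eta> t \<noteq> 0 \<Longrightarrow> a \<le> t \<and> t \<le> b" and "a > 0"
  shows "A * (\<integral>t. deriv \<eta> t * momentum t \<partial>lebesgue_on {0<..})
     \<le> (\<integral>t. \<eta> t * (\<nu> * dissipation t + growth_rate) \<partial>lebesgue_on {0<..})"
proof -
  let ?f = "wall_cutoff \<delta>"
  have supp': "deriv \<eta> t = 0" if "t < a \<or> b < t" for t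
  proof -
    have "\<forall>\<^sub>F s in nhds t. \<eta> s = 0"
      using that eventually_nhds_in_open[of "{..<a}" t] eventually_nhds_in_open[of "{b<..}" t] supp
      by (auto elim!: eventually_mono) (metis not_le)+
    then show ?thesis
      by (auto intro!: DERIV_imp_deriv simp: DERIV_cong_ev[OF refl _ refl])
  qed
  \<comment> \<open>The integrand of the weak formulation for this test field. The velocity and its
    gradient are controlled only on bounded time intervals, so integrability is proved on a cylinder
    reaching beyond the support of \<eta>.\<close>
  define h where "h t x = deriv \<eta> t * (?f (x $ v) * u t x $ i)
      + \<eta> t * (deriv ?f (x $ v) * (u t x $ v * u t x $ i))
      - \<nu> * (\<eta> t * (deriv ?f (x $ v) * G t x $ i $ v))" for t x
  define T where "T = max 1 (b + 1)"
  have T: "T > 0" "b < T" by (auto simp: T_def)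
  define Q where "Q = {0<..<T} \<times> (cell :: (real^'n) set)"
  have Q: "bounded Q" "Q \<in> sets lebesgue"
  proof -
    show "bounded Q" by (auto simp: Q_def cell_eq_box intro!: bounded_Times)
    have "open Q" by (auto simp: Q_def cell_eq_box intro!: open_Times)
    then show "Q \<in> sets lebesgue" by auto
  qed
  have Q_lm: "Q \<in> lmeasurable"
    using Q by (rule bounded_set_imp_lmeasurable)
  have uQ: "in_L2 Q (\<lambda>(t, x). u t x $ j)" for j
    using in_L2_nth[OF u_L2_spacetime[OF T(1)], of j] by (simp add: Q_def case_prod_unfold)
  have GQ: "in_L2 Q (\<lambda>(t, x). G t x $ i $ v)"
    using in_L2_nth_nth[OF G_L2_spacetime[OF T(1)], of i v] by (simp add: Q_def case_prod_unfold)
  have cont: "continuous_on UNIV (\<lambda>z :: real \<times> (real^'n). \<alpha> (fst z) * \<beta> (snd z $ v))"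
    if "continuous_on UNIV \<alpha>" "continuous_on UNIV \<beta>" for \<alpha> \<beta> :: "real \<Rightarrow> real"
    by (intro continuous_intros continuous_on_compose2[OF that(1)] continuous_on_compose2[OF that(2)]) auto
  have c: "continuous_on UNIV \<eta>" "continuous_on UNIV (deriv \<eta>)" "continuous_on UNIV ?f"
      "continuous_on UNIV (deriv ?f)"
    by (intro smooth_continuous_on smooth_deriv smooth_wall_cutoff \<eta>)+
  have "integrable (lebesgue_on Q) (\<lambda>(t, x). h t x)"
  proof -
    have "integrable (lebesgue_on Q) (\<lambda>z. (deriv \<eta> (fst z) * ?f (snd z $ v)) *\<^sub>R u (fst z) (snd z) $ i \<bullet> 1)"
      using uQ[of i] by (intro integrable_inner_L2 in_L2_mult_continuous Q cont c in_L2_const Q_lm)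
        (simp add: case_prod_unfold)
    moreover have "integrable (lebesgue_on Q)
      (\<lambda>z. (\<eta> (fst z) * deriv ?f (snd z $ v)) *\<^sub>R u (fst z) (snd z) $ v \<bullet> u (fst z) (snd z) $ i)"
      using uQ by (intro integrable_inner_L2 in_L2_mult_continuous Q cont c) (simp_all add: case_prod_unfold)
    moreover have "integrable (lebesgue_on Q)
      (\<lambda>z. (\<eta> (fst z) * deriv ?f (snd z $ v)) *\<^sub>R G (fst z) (snd z) $ i $ v \<bullet> 1)"
      using GQ by (intro integrable_inner_L2 in_L2_mult_continuous Q cont c in_L2_const Q_lm)
        (simp add: case_prod_unfold)
    ultimately show ?thesis
      unfolding h_def case_prod_unfold
      by (intro Bochner_Integration.integrable_diff Bochner_Integration.integrable_add
          integrable_mult_right) (simp_all add: ac_simps)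
  qed
  then have hi: "integrable (lebesgue_on ({0<..} \<times> cell)) (\<lambda>(t, x). h t x)"
  proof (rule integrable_lebesgue_on_superset[OF _ Q(2)])
    have "open ({0::real<..} \<times> (cell :: (real^'n) set))" by (auto simp: cell_eq_box intro!: open_Times)
    then show "{0::real<..} \<times> (cell :: (real^'n) set) \<in> sets lebesgue" by auto
    fix z :: "real \<times> (real^'n)" assume z: "z \<in> {0<..} \<times> cell - Q"
    then have "b < fst z" using T by (auto simp: Q_def)
    then have "\<eta> (fst z) = 0" "deriv \<eta> (fst z) = 0" using supp supp' by force+
    then show "(case z of (t, x) \<Rightarrow> h t x) = 0" by (simp add: h_def case_prod_unfold)
  qed (auto simp: Q_def)
  have "(\<integral>t. (\<integral>x. h t x \<partial>lebesgue_on cell) \<partial>lebesgue_on {0<..}) = 0"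
  proof -
    define \<phi> where "\<phi> = (\<lambda>(t, x::real^'n). (\<eta> t * ?f (x $ v)) *\<^sub>R axis i (1::real))"
    have test: "spacetime_test v \<phi>"
      unfolding \<phi>_def
      by (rule spacetime_test_shear[OF \<eta>(1) supp \<open>a > 0\<close> smooth_wall_cutoff wall_cutoff_support \<delta>_pos])
        (use \<delta>_pos in auto)
    have jac: "jacobian (\<lambda>y. \<phi> (t, y)) (at x) = axis i (axis v (\<eta> t * deriv ?f (x $ v)))" for t x
      unfolding \<phi>_def prod.case by (rule jacobian_shear[OF smooth_wall_cutoff])
    have dt: "vector_derivative (\<lambda>s. \<phi> (s, x)) (at t) = (deriv \<eta> t * ?f (x $ v)) *\<^sub>R axis i 1" for t x
      unfolding \<phi>_def prod.case
      using smooth_has_real_derivative[OF \<eta>(1), of t]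
      by (intro vector_derivative_at bounded_linear.has_vector_derivative[OF bounded_linear_scaleR_left])
        (auto intro!: derivative_eq_intros simp flip: has_real_derivative_iff_has_vector_derivative)
    have "\<forall>t x. trace (jacobian (\<lambda>y. \<phi> (t, y)) (at x)) = 0"
      unfolding jac using trace_axis_axis[OF iv] by blast
    then have "(\<integral>(t, x). u t x \<bullet> vector_derivative (\<lambda>s. \<phi> (s, x)) (at t)
            + (jacobian (\<lambda>y. \<phi> (t, y)) (at x) *v u t x) \<bullet> u t x
            - \<nu> * (G t x \<bullet> jacobian (\<lambda>y. \<phi> (t, y)) (at x))
          \<partial>lebesgue_on ({0<..} \<times> cell)) = 0"
      using weak_NSE test unfolding weak_NSE_def by blast
    then have "(\<integral>(t, x). h t x \<partial>lebesgue_on ({0<..} \<times> cell)) = 0"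
      unfolding jac dt h_def axis_axis_mult_vector
      by (simp add: inner_axis inner_axis' ac_simps)
    then show ?thesis
      using integral_lebesgue_on_fst[OF _ cell_borel hi] by simp
  qed
  have inner_eq: "AE t in lebesgue_on {0<..}.
      (\<integral>x. h t x \<partial>lebesgue_on cell) = deriv \<eta> t * momentum t + \<eta> t * flux (u t) (G t)"
    and bound: "AE t in lebesgue_on {0<..}.
      - A * flux (u t) (G t) \<le> \<nu> * dissipation t + growth_rate"
  proof -
    have *: "AE t in lebesgue_on {0<..}. H10 v (u t) (G t) \<and> 0 < t"
      using AE_H10 by (simp add: AE_restrict_space_iff)
    then show "AE t in lebesgue_on {0<..}. - A * flux (u t) (G t) \<le> \<nu> * dissipation t + growth_rate"
      by eventually_elim (simp only: dissipation_def flux_bound)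
    from * show "AE t in lebesgue_on {0<..}.
      (\<integral>x. h t x \<partial>lebesgue_on cell) = deriv \<eta> t * momentum t + \<eta> t * flux (u t) (G t)"
    proof eventually_elim
      case (elim t)
      then have H: "H10 v (u t) (G t)" and "t > 0" by auto
      have 1: "integrable (lebesgue_on cell) (\<lambda>x. ?f (x $ v) * u t x $ i)"
        using integrable_inner_L2[OF u_L2 shear_L2, of t] \<open>t > 0\<close>
        by (simp add: shear_def inner_axis ac_simps)
      have 2: "momentum t = (\<integral>x. ?f (x $ v) * u t x $ i \<partial>lebesgue_on cell)"
        by (simp add: momentum_def L2_inner_def shear_def inner_axis ac_simps)
      have 3: "flux (u t) (G t) = (\<integral>x. deriv ?f (x $ v) * (u t x $ v * u t x $ i) \<partial>lebesgue_on cell)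
          - \<nu> * (\<integral>x. deriv ?f (x $ v) * G t x $ i $ v \<partial>lebesgue_on cell)"
        using integrable_flux_convection[OF H] integrable_flux_viscous[OF H]
        by (simp add: flux_def right_diff_distrib mult.left_commute[of _ \<nu>])
      show ?case
        unfolding h_def 2 3
        using 1 integrable_flux_convection[OF H] integrable_flux_viscous[OF H]
        by (simp add: algebra_simps)
    qed
  qed
  have Mi: "integrable (lebesgue_on {0<..}) (\<lambda>t. deriv \<eta> t * momentum t)"
    by (rule integrable_mult_locally_integrable[OF locally_integrable_continuous[OF continuous_momentum] c(2), of b])
      (use supp' in auto)
  have "locally_integrable (\<lambda>t. \<nu> * dissipation t + growth_rate)"
    using locally_integrable_dissipation locally_integrable_continuous[OF continuous_on_const, of growth_rate]
    by (auto simp: locally_integrable_def)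
  then have Di: "integrable (lebesgue_on {0<..}) (\<lambda>t. \<eta> t * (\<nu> * dissipation t + growth_rate))"
    by (rule integrable_mult_locally_integrable[OF _ c(1), of _ b]) (use supp in force)
  \<comment> \<open>The flux is never integrated in time on its own: it enters through the inner
    integral of \<open>h\<close>, whose integrability Fubini provides, and the bound is applied for
    almost every time.\<close>
  have "(\<integral>t. A * (deriv \<eta> t * momentum t) - \<eta> t * (\<nu> * dissipation t + growth_rate) \<partial>lebesgue_on {0<..})
      \<le> (\<integral>t. A * (\<integral>x. h t x \<partial>lebesgue_on cell) \<partial>lebesgue_on {0<..})"
  proof (rule integral_mono_AE)
    show "AE t in lebesgue_on {0<..}. A * (deriv \<eta> t * momentum t) - \<eta> t * (\<nu> * dissipation t + growth_rate)
        \<le> A * (\<integral>x. h t x \<partial>lebesgue_on cell)"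
      using inner_eq bound
    proof eventually_elim
      case (elim t)
      have "\<eta> t * (- A * flux (u t) (G t)) \<le> \<eta> t * (\<nu> * dissipation t + growth_rate)"
        using elim(2) \<eta>(2) by (intro mult_left_mono) auto
      then show ?case unfolding elim(1) by (simp add: algebra_simps)
    qed
    show "integrable (lebesgue_on {0<..}) (\<lambda>t. A * (\<integral>x. h t x \<partial>lebesgue_on cell))"
      using integrable_lebesgue_on_fst[OF _ cell_borel hi] by simp
  qed (use Mi Di in auto)
  also have "\<dots> = 0"
    using \<open>(\<integral>t. (\<integral>x. h t x \<partial>lebesgue_on cell) \<partial>lebesgue_on {0<..}) = 0\<close> by simp
  finally show ?thesis
    using Mi Di by simp
qed

end

section \<open>The growth of the distance to the shear flow\<close>

text \<open>For positive \<open>r\<close> its derivative is a nonnegative kernel of mass 1 on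
  [b, b + r], a one-sided mollified Dirac mass.\<close>

definition ramp :: "real \<Rightarrow> real \<Rightarrow> real \<Rightarrow> real" where
  "ramp b r t = step ((t - b) / r)"

lemma smooth_ramp: "smooth (ramp b r)"
proof -
  have "ramp b r = (\<lambda>t. step ((1 / r) * t + - b / r))"
    by (auto simp: ramp_def fun_eq_iff diff_divide_distrib)
  then show ?thesis
    using smooth_affine[OF smooth_step, of "1 / r" "- b / r"] by simp
qed

lemma deriv_ramp:
  assumes "r > 0"
  shows "deriv (ramp b r) t = deriv step ((t - b) / r) / r"
proof (rule DERIV_imp_deriv)
  show "(ramp b r has_real_derivative deriv step ((t - b) / r) / r) (at t)"
    unfolding ramp_def[abs_def]
    by (rule DERIV_cong[OF DERIV_chain2[OF smooth_has_real_derivative[OF smooth_step]], of _ "1 / r"])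
      (use assms in \<open>auto intro!: derivative_eq_intros\<close>)
qed

lemma deriv_ramp_nonneg: "r > 0 \<Longrightarrow> 0 \<le> deriv (ramp b r) t"
  by (simp add: deriv_ramp step_deriv_nonneg)

lemma deriv_ramp_eq_0: "r > 0 \<Longrightarrow> t < b \<or> b + r < t \<Longrightarrow> deriv (ramp b r) t = 0"
  by (subst deriv_ramp) (auto intro!: step_deriv_eq_0 simp: field_simps)

lemma ramp_eq_0: "r > 0 \<Longrightarrow> t \<le> b \<Longrightarrow> ramp b r t = 0"
  by (simp add: ramp_def step_eq_0 divide_nonpos_pos)

lemma ramp_eq_1: "r > 0 \<Longrightarrow> b + r \<le> t \<Longrightarrow> ramp b r t = 1"
  by (simp add: ramp_def step_eq_1 field_simps)

lemma ramp_le_1: "ramp b r t \<le> 1"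
  by (simp add: ramp_def step_le_1)

lemma ramp_mono: "r > 0 \<Longrightarrow> b \<le> c \<Longrightarrow> ramp c r t \<le> ramp b r t"
  by (auto simp: ramp_def intro!: step_mono divide_right_mono)

lemma continuous_deriv_ramp: "continuous_on S (deriv (ramp b r))"
  by (intro smooth_continuous_on smooth_deriv smooth_ramp)

lemma integral_deriv_ramp:
  assumes "r > 0" "b \<ge> 0"
  shows "(\<integral>t. deriv (ramp b r) t \<partial>lebesgue_on {0<..}) = 1"
proof -
  have "(\<integral>t. deriv (ramp b r) t \<partial>lebesgue_on {0<..})
      = (\<integral>t. indicat_real {0<..} t *\<^sub>R deriv (ramp b r) t \<partial>lebesgue)"
    by (subst integral_restrict_space) auto
  also have "\<dots> = (\<integral>t. indicat_real {b..b + r} t *\<^sub>R deriv (ramp b r) t \<partial>lebesgue)"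
  proof (rule integral_cong_AE)
    have "deriv (ramp b r) \<in> borel_measurable borel"
      by (rule borel_measurable_continuous_onI[OF continuous_deriv_ramp])
    then show "(\<lambda>t. indicat_real {0<..} t *\<^sub>R deriv (ramp b r) t) \<in> borel_measurable lebesgue"
      "(\<lambda>t. indicat_real {b..b + r} t *\<^sub>R deriv (ramp b r) t) \<in> borel_measurable lebesgue"
      by (auto intro!: measurable_completion)
    \<comment> \<open>For \<open>b = 0\<close> the closed interval contains the endpoint 0, which
      the half-line omits.\<close>
    have "AE t in lebesgue. t \<noteq> (0::real)"
      by (rule AE_completion) (rule AE_lborel_singleton)
    then show "AE t in lebesgue. indicat_real {0<..} t *\<^sub>R deriv (ramp b r) t
        = indicat_real {b..b + r} t *\<^sub>R deriv (ramp b r) t"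
      by eventually_elim
        (use assms deriv_ramp_eq_0[OF assms(1), of _ b] in \<open>auto simp: indicator_def not_le\<close>)
  qed
  also have "\<dots> = (\<integral>t. indicat_real {b..b + r} t *\<^sub>R deriv (ramp b r) t \<partial>lborel)"
    using borel_measurable_continuous_onI[OF continuous_deriv_ramp] by (intro integral_completion) auto
  also have "\<dots> = ramp b r (b + r) - ramp b r b"
  proof (rule integral_FTC_Icc)
    show "(ramp b r has_vector_derivative deriv (ramp b r) t) (at t within {b..b + r})" for t
      using smooth_has_real_derivative[OF smooth_ramp, of b r t]
      by (metis has_real_derivative_iff_has_vector_derivative has_vector_derivative_at_within)
  qed (use assms continuous_deriv_ramp in auto)
  also have "\<dots> = 1"
    using assms by (simp add: ramp_eq_0 ramp_eq_1)
  finally show ?thesis .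
qed

lemma integrable_deriv_ramp_mult:
  assumes "r > 0" "locally_integrable k"
  shows "integrable (lebesgue_on {0<..}) (\<lambda>t. deriv (ramp b r) t * k t)"
  by (rule integrable_mult_locally_integrable[OF assms(2) continuous_deriv_ramp, of "b + r"])
    (use assms(1) deriv_ramp_eq_0 in auto)

text \<open>One-sided bounds suffice at both ends of the time interval: from below for
  \<open>energy - A momentum\<close> just after \<open>a\<close>, and from below for
  \<open>A momentum\<close> near 0.\<close>

lemma ramp_average_ge:
  assumes r: "r > 0" and b: "b \<ge> 0" and k: "locally_integrable k"
    and ge: "\<And>t. t > 0 \<Longrightarrow> b \<le> t \<Longrightarrow> t \<le> b + r \<Longrightarrow> c \<le> k t"
  shows "c \<le> (\<integral>t. deriv (ramp b r) t * k t \<partial>lebesgue_on {0<..})"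
proof -
  have "c = (\<integral>t. deriv (ramp b r) t * c \<partial>lebesgue_on {0<..})"
    using integral_deriv_ramp[OF r b] by simp
  also have "\<dots> \<le> (\<integral>t. deriv (ramp b r) t * k t \<partial>lebesgue_on {0<..})"
  proof (rule integral_mono)
    fix t :: real assume "t \<in> space (lebesgue_on {0<..})"
    then show "deriv (ramp b r) t * c \<le> deriv (ramp b r) t * k t"
      using ge[of t] deriv_ramp_nonneg[OF r, of b t] deriv_ramp_eq_0[OF r, of t b]
      by (cases "b \<le> t \<and> t \<le> b + r") (auto intro!: mult_left_mono simp: not_le)
  qed (intro integrable_deriv_ramp_mult r k locally_integrable_continuous continuous_on_const)+
  finally show ?thesis .
qed

section \<open>From distributional balances to bounds at every time\<close>

context channel_solution
begin

text \<open>The energy is tested with \<eta>, equal to 1 at time 0, and the momentum with \<theta>,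
  which vanishes before \<open>r\<close>. Both descend along the same ramp at \<open>a\<close>, so
  their sum controls an average of \<open>energy - A momentum\<close> there; the rise of \<theta>
  leaves an average of the momentum over [r, 2r].\<close>

lemma smoothed_energy_inequality:
  assumes r: "r > 0" and a: "2 * r < a"
  shows "(\<integral>t. deriv (ramp a r) t * energy t \<partial>lebesgue_on {0<..})
      + A * (\<integral>t. deriv (ramp r r) t * momentum t \<partial>lebesgue_on {0<..})
      - A * (\<integral>t. deriv (ramp a r) t * momentum t \<partial>lebesgue_on {0<..})
    \<le> energy 0 + growth_rate * (a + r)"
proof -
  \<comment> \<open>The ramp starting at -2 only serves to give \<eta> compact support; it equals 1
    from time -1 on and is invisible at positive times.\<close>
  define \<eta> where "\<eta> t = ramp (-2) 1 t - ramp a r t" for t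
  define \<theta> where "\<theta> t = ramp r r t - ramp a r t" for t
  have a0: "a > 0" using r a by linarith
  have \<eta>s: "smooth \<eta>" and \<theta>s: "smooth \<theta>"
    unfolding \<eta>_def[abs_def] \<theta>_def[abs_def] by (intro smooth_diff smooth_ramp)+
  have \<eta>0: "0 \<le> \<eta> t" for t
    using ramp_eq_0[OF r, of t a] ramp_eq_1[of 1 "-2" t] ramp_le_1[of a r t] a0
    by (cases "t \<le> a") (auto simp: \<eta>_def ramp_def step_nonneg)
  have \<theta>0: "0 \<le> \<theta> t" for t
    unfolding \<theta>_def using ramp_mono[OF r, of r a t] r a by simp
  have \<theta>\<eta>: "\<theta> t \<le> \<eta> t" if "t > 0" for t
    unfolding \<theta>_def \<eta>_def using ramp_le_1[of r r t] ramp_eq_1[of 1 "-2" t] that by simp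
  have \<theta>_supp: "r \<le> t \<and> t \<le> a + r" if "\<theta> t \<noteq> 0" for t
  proof (rule ccontr)
    assume "\<not> ?thesis"
    then consider "t < r" | "a + r < t" by linarith
    then have "\<theta> t = 0"
      by cases (use r a in \<open>auto simp: \<theta>_def ramp_eq_0 ramp_eq_1\<close>)
    then show False using that by simp
  qed
  have \<eta>_supp: "\<bar>t\<bar> \<le> a + r + 2" if "\<eta> t \<noteq> 0" for t
  proof (rule ccontr)
    assume "\<not> ?thesis"
    then consider "t < -2" | "a + r < t" using r a by linarith
    then have "\<eta> t = 0"
      by cases (use r a in \<open>auto simp: \<eta>_def ramp_eq_0 ramp_eq_1\<close>)
    then show False using that by simp
  qed
  have dd: "deriv (\<lambda>t. ramp b s t - ramp c r t) t = deriv (ramp b s) t - deriv (ramp c r) t" for b s c t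
    by (rule DERIV_imp_deriv) (intro DERIV_diff smooth_has_real_derivative smooth_ramp)
  have d\<theta>: "deriv \<theta> t = deriv (ramp r r) t - deriv (ramp a r) t" for t
    unfolding \<theta>_def[abs_def] dd ..
  have d\<eta>: "deriv \<eta> t = - deriv (ramp a r) t" if "t > 0" for t
    unfolding \<eta>_def[abs_def] dd using that deriv_ramp_eq_0[of 1 t "-2"] by simp
  have \<eta>_0: "\<eta> 0 = 1"
    unfolding \<eta>_def using ramp_eq_0[OF r, of 0 a] ramp_eq_1[of 1 "-2" 0] a0 by simp
  note Mi = locally_integrable_continuous[OF continuous_momentum]
  have 1: "A * (\<integral>t. deriv (ramp r r) t * momentum t \<partial>lebesgue_on {0<..})
      - A * (\<integral>t. deriv (ramp a r) t * momentum t \<partial>lebesgue_on {0<..})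
      \<le> (\<integral>t. \<theta> t * (\<nu> * dissipation t + growth_rate) \<partial>lebesgue_on {0<..})"
    using momentum_inequality[OF \<theta>s \<theta>0 \<theta>_supp r]
      integrable_deriv_ramp_mult[OF r Mi, of r] integrable_deriv_ramp_mult[OF r Mi, of a]
    by (simp add: d\<theta> left_diff_distrib right_diff_distrib)
  have D\<theta>: "integrable (lebesgue_on {0<..}) (\<lambda>t. \<theta> t * dissipation t)"
    by (rule integrable_mult_locally_integrable[OF locally_integrable_dissipation
          smooth_continuous_on[OF \<theta>s], of "a + r"]) (use \<theta>_supp in force)
  have D\<eta>: "integrable (lebesgue_on {0<..}) (\<lambda>t. \<eta> t * dissipation t)"
    by (rule integrable_mult_locally_integrable[OF locally_integrable_dissipation
          smooth_continuous_on[OF \<eta>s], of "a + r + 2"]) (use \<eta>_supp in force)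
  have K\<theta>: "integrable (lebesgue_on {0<..}) (\<lambda>t. \<theta> t * growth_rate)"
    by (rule integrable_mult_locally_integrable[OF
          locally_integrable_continuous[OF continuous_on_const] smooth_continuous_on[OF \<theta>s], of "a + r"])
      (use \<theta>_supp in force)
  have 2: "(\<integral>t. \<theta> t * (\<nu> * dissipation t + growth_rate) \<partial>lebesgue_on {0<..})
      = \<nu> * (\<integral>t. \<theta> t * dissipation t \<partial>lebesgue_on {0<..}) + (\<integral>t. \<theta> t * growth_rate \<partial>lebesgue_on {0<..})"
    using D\<theta> K\<theta> by (simp add: distrib_left mult.left_commute[of _ \<nu>])
  have 3: "(\<integral>t. \<theta> t * growth_rate \<partial>lebesgue_on {0<..}) \<le> growth_rate * (a + r)"
  proof -
    have fin: "integrable lebesgue (indicat_real {0<..a + r})"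
      using a0 r by (intro integrable_real_indicator) auto
    have "(\<integral>t. \<theta> t * growth_rate \<partial>lebesgue_on {0<..})
        \<le> (\<integral>t. indicat_real {0<..a + r} t * growth_rate \<partial>lebesgue_on {0<..})"
    proof (rule integral_mono[OF K\<theta>])
      show "integrable (lebesgue_on {0<..}) (\<lambda>t. indicat_real {0<..a + r} t * growth_rate)"
      proof (intro integrable_mult_left)
        have "(\<lambda>t. indicat_real {0<..} t *\<^sub>R indicat_real {0<..a + r} t) = indicat_real {0<..a + r}"
          by (auto simp: indicator_def)
        then show "integrable (lebesgue_on {0<..}) (indicat_real {0<..a + r})"
          using fin by (subst integrable_restrict_space) simp_all
      qed
      fix t :: real assume "t \<in> space (lebesgue_on {0<..})"
      moreover have "\<theta> t \<le> 1" unfolding \<theta>_def using ramp_le_1[of r r t] step_nonneg[of "(t - a) / r"]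
        by (simp add: ramp_def[of a])
      ultimately show "\<theta> t * growth_rate \<le> indicat_real {0<..a + r} t * growth_rate"
        using \<theta>_supp[of t] growth_rate_pos by (cases "\<theta> t = 0") (auto simp: indicator_def)
    qed
    also have "\<dots> = (\<integral>t. indicat_real {0<..a + r} t \<partial>lebesgue_on {0<..}) * growth_rate"
      by simp
    also have "(\<integral>t. indicat_real {0<..a + r} t \<partial>lebesgue_on {0<..}) = a + r"
    proof -
      have "(\<integral>t. indicat_real {0<..a + r} t \<partial>lebesgue_on {0<..})
        = (\<integral>t. indicat_real {0<..} t *\<^sub>R indicat_real {0<..a + r} t \<partial>lebesgue)"
        by (subst integral_restrict_space) auto
      also have "\<dots> = (\<integral>t. indicat_real {0<..a + r} t \<partial>lebesgue)"
        by (intro Bochner_Integration.integral_cong) (auto simp: indicator_def)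
      finally show ?thesis using a0 r by simp
    qed
    finally show ?thesis by (simp add: mult.commute)
  qed
  \<comment> \<open>This lets the dissipation produced by the momentum balance be paid by the energy
    inequality: \<theta> \<le> \<eta> at positive times and the dissipation is nonnegative.\<close>
  have 4: "(\<integral>t. \<theta> t * dissipation t \<partial>lebesgue_on {0<..}) \<le> (\<integral>t. \<eta> t * dissipation t \<partial>lebesgue_on {0<..})"
    by (rule integral_mono[OF D\<theta> D\<eta>])
      (auto intro!: mult_right_mono \<theta>\<eta> simp: dissipation_def L2_inner_self_nonneg)
  have 5: "- (\<integral>t. deriv \<eta> t * (enn2real (L2sq cell (u t)) / 2) \<partial>lebesgue_on {0<..})
          - \<eta> 0 * (enn2real (L2sq cell (u 0)) / 2)
        \<le> - \<nu> * (\<integral>t. \<eta> t * enn2real (L2sq cell (G t)) \<partial>lebesgue_on {0<..})"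
    using energy_inequality \<eta>s \<eta>0 \<eta>_supp unfolding energy_inequality_def by blast
  have 6: "(\<integral>t. deriv \<eta> t * (enn2real (L2sq cell (u t)) / 2) \<partial>lebesgue_on {0<..})
     = - (\<integral>t. deriv (ramp a r) t * energy t \<partial>lebesgue_on {0<..})"
    by (subst integral_minus[symmetric], intro Bochner_Integration.integral_cong)
      (auto simp: d\<eta> energy_def enn2real_L2sq u_L2)
  have 7: "(\<integral>t. \<eta> t * enn2real (L2sq cell (G t)) \<partial>lebesgue_on {0<..})
     = (\<integral>t. \<eta> t * dissipation t \<partial>lebesgue_on {0<..})"
  proof -
    \<comment> \<open>\<open>enn2real\<close> agrees with the inner product only where
      \<open>G t\<close> is in L2, that is for almost every time.\<close>
    have ae: "AE t in lebesgue_on {0<..}. \<eta> t * dissipation t = \<eta> t * enn2real (L2sq cell (G t))"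
    proof -
      have "AE t in lebesgue_on {0<..}. H10 v (u t) (G t)"
        using AE_H10 by (simp add: AE_restrict_space_iff)
      then show ?thesis
        by eventually_elim (simp add: dissipation_def enn2real_L2sq H10_def)
    qed
    show ?thesis
      using integral_cong_AE_lebesgue_on[OF _ borel_measurable_integrable[OF D\<eta>] ae] by simp
  qed
  have "energy 0 = enn2real (L2sq cell (u 0)) / 2"
    by (simp add: energy_def enn2real_L2sq u_L2)
  then have "(\<integral>t. deriv (ramp a r) t * energy t \<partial>lebesgue_on {0<..}) - energy 0
      \<le> - \<nu> * (\<integral>t. \<eta> t * dissipation t \<partial>lebesgue_on {0<..})"
    using 5 unfolding 6 7 \<eta>_0 by simp
  also have "\<dots> \<le> - (\<nu> * (\<integral>t. \<theta> t * dissipation t \<partial>lebesgue_on {0<..}))"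
    using 4 \<nu> by simp
  finally show ?thesis
    using 1 2 3 by linarith
qed

text \<open>The bound holds at every time, not only almost everywhere: by weak continuity in time,
  \<open>p\<close> below is a continuous minorant of \<open>energy - A momentum\<close> that touches it at \<open>a\<close>.\<close>

lemma energy_momentum_growth:
  assumes a: "a > 0"
  shows "energy a - A * momentum a \<le> energy 0 - A * momentum 0 + growth_rate * a"
proof (rule field_le_epsilon)
  fix \<epsilon> :: real assume "\<epsilon> > 0"
  \<comment> \<open>Expanding the squared distance of \<open>u t\<close> and \<open>u a\<close>
    bounds the energy at \<open>t\<close> from below by the pairing of \<open>u t\<close> with
    \<open>u a\<close> minus the energy at \<open>a\<close>, with equality at \<open>t = a\<close>.
    The pairing is continuous in \<open>t\<close> although the energy need not be.\<close>
  define p where "p t = L2_inner cell (u t) (u a) - energy a - A * momentum t" for t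
  have p_cont: "continuous_on {0..} p"
    unfolding p_def[abs_def]
    by (intro continuous_intros u_weakly_continuous u_L2 continuous_momentum) (use a in auto)
  have p_le: "p t \<le> energy t - A * momentum t" if "t \<ge> 0" for t
    using L2_inner_le[OF u_L2[OF that] u_L2, of a] a by (simp add: p_def energy_def)
  have p_a: "p a = energy a - A * momentum a"
    by (simp add: p_def energy_def)
  \<comment> \<open>Three errors: \<open>p\<close> near \<open>a\<close>, \<open>A momentum\<close>
    near 0, and \<open>growth_rate * r\<close>.\<close>
  define \<epsilon>' where "\<epsilon>' = \<epsilon> / 3"
  have \<epsilon>': "\<epsilon>' > 0" using \<open>\<epsilon> > 0\<close> by (simp add: \<epsilon>'_def)
  obtain d1 where d1: "d1 > 0" "\<And>t. t \<ge> 0 \<Longrightarrow> dist t a < d1 \<Longrightarrow> dist (p t) (p a) < \<epsilon>'"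
    using p_cont a \<epsilon>' unfolding continuous_on_iff by (metis atLeast_iff less_imp_le)
  have "continuous_on {0..} (\<lambda>t. A * momentum t)"
    by (intro continuous_intros continuous_momentum)
  then obtain d2 where d2: "d2 > 0"
    "\<And>t. t \<ge> 0 \<Longrightarrow> dist t 0 < d2 \<Longrightarrow> dist (A * momentum t) (A * momentum 0) < \<epsilon>'"
    using \<epsilon>' unfolding continuous_on_iff by (metis atLeast_iff order_refl)
  \<comment> \<open>The four bounds keep [a, a + r] within \<open>d1\<close> of \<open>a\<close>,
    keep [r, 2r] within \<open>d2\<close> of 0, ensure 2r < a, and make
    \<open>growth_rate * r\<close> at most one error.\<close>
  define r where "r = min (min (d1 / 2) (d2 / 4)) (min (a / 4) (\<epsilon>' / growth_rate))"
  have r: "r > 0"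
    using d1(1) d2(1) a \<epsilon>' growth_rate_pos by (simp add: r_def)
  have r': "r < d1" "2 * r < d2" "2 * r < a"
    using d1(1) d2(1) a unfolding r_def by linarith+
  have r'': "growth_rate * r \<le> \<epsilon>'"
  proof -
    have "r \<le> \<epsilon>' / growth_rate" by (simp add: r_def)
    then show ?thesis using growth_rate_pos by (simp add: field_simps)
  qed
  note Mi = locally_integrable_continuous[OF continuous_momentum]
  have AMi: "locally_integrable (\<lambda>t. A * momentum t)"
    using Mi by (simp add: locally_integrable_def)
  have EMi: "locally_integrable (\<lambda>t. energy t - A * momentum t)"
    using AMi locally_integrable_energy by (simp add: locally_integrable_def)
  have 1: "p a - \<epsilon>' \<le> (\<integral>t. deriv (ramp a r) t * (energy t - A * momentum t) \<partial>lebesgue_on {0<..})"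
  proof (rule ramp_average_ge[OF r _ EMi])
    fix t assume t: "t > 0" "a \<le> t" "t \<le> a + r"
    then have "dist (p t) (p a) < \<epsilon>'" using r' by (intro d1) (auto simp: dist_real_def)
    then show "p a - \<epsilon>' \<le> energy t - A * momentum t"
      using p_le[of t] t by (simp add: dist_real_def)
  qed (use a in simp)
  have 2: "A * momentum 0 - \<epsilon>' \<le> (\<integral>t. deriv (ramp r r) t * (A * momentum t) \<partial>lebesgue_on {0<..})"
  proof (rule ramp_average_ge[OF r _ AMi])
    fix t assume t: "t > 0" "r \<le> t" "t \<le> r + r"
    then have "dist (A * momentum t) (A * momentum 0) < \<epsilon>'"
      using r' by (intro d2) (auto simp: dist_real_def)
    then show "A * momentum 0 - \<epsilon>' \<le> A * momentum t" by (simp add: dist_real_def)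
  qed (use r in simp)
  have 3: "(\<integral>t. deriv (ramp a r) t * (energy t - A * momentum t) \<partial>lebesgue_on {0<..})
    = (\<integral>t. deriv (ramp a r) t * energy t \<partial>lebesgue_on {0<..})
      - A * (\<integral>t. deriv (ramp a r) t * momentum t \<partial>lebesgue_on {0<..})"
    using integrable_deriv_ramp_mult[OF r locally_integrable_energy, of a]
      integrable_deriv_ramp_mult[OF r Mi, of a]
    by (simp add: right_diff_distrib mult.left_commute[of _ A])
  have 4: "(\<integral>t. deriv (ramp r r) t * (A * momentum t) \<partial>lebesgue_on {0<..})
    = A * (\<integral>t. deriv (ramp r r) t * momentum t \<partial>lebesgue_on {0<..})"
    by (simp add: mult.left_commute[of _ A])
  have "p a - \<epsilon>' + (A * momentum 0 - \<epsilon>') \<le> energy 0 + growth_rate * (a + r)"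
    using smoothed_energy_inequality[OF r r'(3)] 1 2 unfolding 3 4 by linarith
  then show "energy a - A * momentum a \<le> energy 0 - A * momentum 0 + growth_rate * a + \<epsilon>"
    using r'' unfolding p_a by (simp add: \<epsilon>'_def distrib_left)
qed

definition deviation :: "real \<Rightarrow> real" where
  "deviation t = L2_inner cell (\<lambda>x. u t x - A *\<^sub>R axis i 1) (\<lambda>x. u t x - A *\<^sub>R axis i 1)"

text \<open>Half the deviation is \<open>energy - A momentum\<close> up to a constant in time and a
  pairing with the part of \<open>e_1\<close> removed by the cutoff. That part has L2 norm at most 2
  sqrt \<delta>, as it lives in a slab of measure 4 \<delta>; Cauchy-Schwarz and Young turn the
  pairing into the perturbed factors and the last term.\<close>

lemma deviation_growth:
  assumes a: "a > 0"
  shows "(1 - 2 * sqrt \<delta>) * deviation a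
    \<le> (1 + 2 * sqrt \<delta>) * deviation 0 + 2 * growth_rate * a + 4 * A\<^sup>2 * sqrt \<delta>"
proof -
  define \<sigma> where "\<sigma> = 2 * sqrt \<delta>"
  have \<sigma>: "\<sigma> > 0" "\<sigma>\<^sup>2 = 4 * \<delta>"
    using \<delta>_pos by (simp_all add: \<sigma>_def power_mult_distrib)
  define e :: "real^'n \<Rightarrow> real^'n" where "e = (\<lambda>x. axis i 1)"
  define \<omega> where "\<omega> x = e x - shear x" for x
  have e: "in_L2 cell e" unfolding e_def by (rule in_L2_const[OF cell_lmeasurable])
  have \<omega>: "in_L2 cell \<omega>" unfolding \<omega>_def[abs_def] by (rule in_L2_diff[OF e shear_L2])
  have \<omega>_small: "L2_inner cell \<omega> \<omega> \<le> \<sigma>\<^sup>2"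
  proof -
    have pt: "\<omega> x \<bullet> \<omega> x \<le> indicat_real (wall_slab v (2 * \<delta>)) x" if "x \<in> cell" for x
    proof -
      have "\<omega> x = (1 - wall_cutoff \<delta> (x $ v)) *\<^sub>R axis i 1"
        by (simp add: \<omega>_def e_def shear_def scaleR_diff_left)
      then have *: "\<omega> x \<bullet> \<omega> x = (1 - wall_cutoff \<delta> (x $ v))\<^sup>2"
        by (simp add: inner_axis axis_nth power2_eq_square)
      show ?thesis
      proof (cases "x \<in> wall_slab v (2 * \<delta>)")
        case True
        have "(1 - wall_cutoff \<delta> (x $ v))\<^sup>2 \<le> 1\<^sup>2"
          using wall_cutoff_range[of \<delta> "x $ v"] by (intro power_mono) auto
        then show ?thesis using True * by simp
      next
        case False
        then show ?thesis
          using that * wall_cutoff_eq_1[OF \<delta>_pos, of "x $ v"] by (simp add: wall_slab_def)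
      qed
    qed
    have fm: "wall_slab v (2 * \<delta>) \<in> lmeasurable" by (rule wall_slab_lmeasurable)
    have ind: "indicat_real cell x *\<^sub>R indicat_real (wall_slab v (2 * \<delta>)) x
        = indicat_real (wall_slab v (2 * \<delta>)) x" for x
      by (auto simp: wall_slab_def indicator_def)
    have int: "integrable lebesgue (indicat_real (wall_slab v (2 * \<delta>)))"
      using fm by (auto simp: fmeasurable_def)
    have "L2_inner cell \<omega> \<omega> \<le> (\<integral>x. indicat_real (wall_slab v (2 * \<delta>)) x \<partial>lebesgue_on cell)"
      unfolding L2_inner_def
    proof (rule integral_mono)
      show "integrable (lebesgue_on cell) (indicat_real (wall_slab v (2 * \<delta>)))"
        by (subst integrable_restrict_space) (use cell_sets_lebesgue int in \<open>simp_all only: ind, auto\<close>)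
    qed (use pt \<omega> in \<open>auto simp: in_L2_iff\<close>)
    also have "\<dots> = (\<integral>x. indicat_real cell x *\<^sub>R indicat_real (wall_slab v (2 * \<delta>)) x \<partial>lebesgue)"
      by (subst integral_restrict_space) (use cell_sets_lebesgue in auto)
    also have "\<dots> = measure lebesgue (wall_slab v (2 * \<delta>))"
      unfolding ind by simp
    also have "\<dots> \<le> 4 * \<delta>"
      using measure_wall_slab[of "2 * \<delta>" v] \<delta>(2) less_imp_le[OF \<delta>_pos] by simp
    finally show ?thesis unfolding \<sigma>(2) .
  qed
  define w where "w t x = u t x - A *\<^sub>R e x" for t x
  have w: "in_L2 cell (w t)" if "t \<ge> 0" for t
    unfolding w_def[abs_def] by (intro in_L2_diff in_L2_scaleR u_L2 e that)
  have dev: "deviation t = L2_inner cell (w t) (w t)" for t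
    by (simp add: deviation_def w_def[abs_def] e_def)
  \<comment> \<open>The last two terms do not depend on time and cancel between \<open>a\<close> and
    0.\<close>
  have expand: "deviation t / 2 = energy t - A * momentum t - A * L2_inner cell (w t) \<omega>
      - A\<^sup>2 * L2_inner cell e \<omega> + A\<^sup>2 * L2_inner cell e e / 2" if "t \<ge> 0" for t
  proof -
    have "deviation t = L2_inner cell (u t) (u t) - 2 * (A * L2_inner cell (u t) e) + A\<^sup>2 * L2_inner cell e e"
      unfolding dev w_def[abs_def]
      using L2_inner_diff_self[OF u_L2[OF that] in_L2_scaleR[OF e, of A]]
      by (simp add: L2_inner_scaleR_left L2_inner_scaleR_right power2_eq_square)
    moreover have "L2_inner cell (u t) \<omega> = L2_inner cell (u t) e - momentum t"
      unfolding \<omega>_def[abs_def] momentum_def by (rule L2_inner_diff_right[OF e shear_L2 u_L2[OF that]])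
    moreover have "L2_inner cell (w t) \<omega> = L2_inner cell (u t) \<omega> - A * L2_inner cell e \<omega>"
      unfolding w_def[abs_def] L2_inner_diff_left[OF u_L2[OF that] in_L2_scaleR[OF e] \<omega>]
      by (simp add: L2_inner_scaleR_left)
    ultimately have "L2_inner cell (u t) e = momentum t + L2_inner cell (w t) \<omega> + A * L2_inner cell e \<omega>"
      and "deviation t = 2 * energy t - 2 * (A * L2_inner cell (u t) e) + A\<^sup>2 * L2_inner cell e e"
      by (simp_all add: energy_def)
    then show ?thesis
      by (simp add: field_simps power2_eq_square)
  qed
  have small: "\<bar>A * L2_inner cell (w t) \<omega>\<bar> \<le> (\<sigma> * deviation t + A\<^sup>2 * \<sigma>) / 2" if "t \<ge> 0" for t
  proof -
    have "\<bar>L2_inner cell (w t) \<omega>\<bar> \<le> sqrt (deviation t) * sqrt (L2_inner cell \<omega> \<omega>)"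
      unfolding dev by (rule L2_Cauchy_Schwarz[OF w[OF that] \<omega>])
    also have "\<dots> \<le> sqrt (deviation t) * \<sigma>"
      using \<omega>_small \<sigma>(1) real_sqrt_le_mono[OF \<omega>_small]
      by (intro mult_left_mono) (auto simp: dev L2_inner_self_nonneg)
    finally have "A * \<bar>L2_inner cell (w t) \<omega>\<bar> \<le> A * (sqrt (deviation t) * \<sigma>)"
      using A by (intro mult_left_mono) auto
    also have "\<dots> = \<sigma> * (A * sqrt (deviation t))" by simp
    also have "\<dots> \<le> \<sigma> * ((A\<^sup>2 + (sqrt (deviation t))\<^sup>2) / 2)"
      using sum_squares_bound[of A "sqrt (deviation t)"] \<sigma>(1) by (intro mult_left_mono) auto
    also have "(sqrt (deviation t))\<^sup>2 = deviation t"
      by (simp add: dev L2_inner_self_nonneg)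
    finally show ?thesis using A by (simp add: abs_mult algebra_simps)
  qed
  have "deviation a / 2 + A * L2_inner cell (w a) \<omega>
      \<le> deviation 0 / 2 + A * L2_inner cell (w 0) \<omega> + growth_rate * a"
    using energy_momentum_growth[OF a] expand[of a] expand[of 0] a by linarith
  moreover have "- (A * L2_inner cell (w a) \<omega>) \<le> (\<sigma> * deviation a + A\<^sup>2 * \<sigma>) / 2"
    "A * L2_inner cell (w 0) \<omega> \<le> (\<sigma> * deviation 0 + A\<^sup>2 * \<sigma>) / 2"
    using small[of a] small[of 0] a by linarith+
  ultimately have "deviation a \<le> deviation 0 + 2 * growth_rate * a + \<sigma> * deviation a + \<sigma> * deviation 0 + 2 * (A\<^sup>2 * \<sigma>)"
    by simp
  then show ?thesis
    unfolding \<sigma>_def by (simp add: algebra_simps)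
qed

end

section \<open>The inviscid limit\<close>

lemma
  fixes f :: "real \<Rightarrow> real^'n \<Rightarrow> 'b::euclidean_space"
  assumes f: "in_L2 ({0<..<T} \<times> cell) (\<lambda>(t, x). f t x)"
  shows integrable_L2_slices: "integrable (lebesgue_on {0<..<T}) (\<lambda>t. L2_inner cell (f t) (f t))"
    and AE_integrable_L2_slices:
      "AE t in lebesgue_on {0<..<T}. integrable (lebesgue_on cell) (\<lambda>x. f t x \<bullet> f t x)"
    and integral_L2_slices: "(\<integral>t. L2_inner cell (f t) (f t) \<partial>lebesgue_on {0<..<T})
      = L2_inner ({0<..<T} \<times> cell) (\<lambda>(t, x). f t x) (\<lambda>(t, x). f t x)"
proof -
  have i: "integrable (lebesgue_on ({0<..<T} \<times> cell)) (\<lambda>(t, x). f t x \<bullet> f t x)"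
    using integrable_inner_L2[OF f f] by (simp add: case_prod_unfold)
  have S: "{0<..<T} \<in> sets borel" by simp
  show "integrable (lebesgue_on {0<..<T}) (\<lambda>t. L2_inner cell (f t) (f t))"
    unfolding L2_inner_def by (rule integrable_lebesgue_on_fst[OF S cell_borel i])
  show "AE t in lebesgue_on {0<..<T}. integrable (lebesgue_on cell) (\<lambda>x. f t x \<bullet> f t x)"
    by (rule AE_integrable_lebesgue_on_fst[OF S cell_borel i])
  show "(\<integral>t. L2_inner cell (f t) (f t) \<partial>lebesgue_on {0<..<T})
      = L2_inner ({0<..<T} \<times> cell) (\<lambda>(t, x). f t x) (\<lambda>(t, x). f t x)"
    unfolding L2_inner_def integral_lebesgue_on_fst[OF S cell_borel i] by (simp add: case_prod_unfold)
qed

text \<open>Fixes the layer width in terms of the viscosity and hides the gradient; the smallness of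
  \<sigma> is the smallness of the viscosity.\<close>

lemma leray_hopf_deviation:
  fixes u :: "real \<Rightarrow> real^'n \<Rightarrow> real^'n" and i v :: 'n
  assumes "i \<noteq> v" "A > 0" "\<nu> > 0" and B: "B > 0" "\<And>x. deriv step x \<le> B"
    and LH: "leray_hopf v \<nu> u"
    and \<sigma>: "\<sigma> = 2 * sqrt (\<nu> / (16 * A * B * exp 2))" "\<sigma> < 1"
    and t: "t > 0"
    and dev: "\<And>t. dev t = L2_inner cell (\<lambda>x. u t x - A *\<^sub>R axis i 1) (\<lambda>x. u t x - A *\<^sub>R axis i 1)"
  shows "(1 - \<sigma>) * dev t \<le> (1 + \<sigma>) * dev 0 + 256 * B ^ 3 * exp 2 * A ^ 3 * t + 2 * A\<^sup>2 * \<sigma>"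
proof -
  define \<delta> where "\<delta> = \<nu> / (16 * A * B * exp 2)"
  have \<delta>0: "\<delta> > 0" unfolding \<delta>_def using assms by simp
  have \<delta>: "16 * A * B * exp 2 * \<delta> = \<nu>"
    unfolding \<delta>_def using assms(2) B(1) by simp
  have "sqrt \<delta> < 1 / 2" using \<sigma> by (simp add: \<delta>_def)
  then have "(sqrt \<delta>)\<^sup>2 < (1 / 2)\<^sup>2" using \<delta>0 by (intro power_strict_mono) auto
  then have "2 * \<delta> \<le> 1" using \<delta>0 by (simp add: power2_eq_square)
  moreover obtain G where "energy_class v u G" "weak_NSE v \<nu> u G" "energy_inequality \<nu> u G"
    using LH unfolding leray_hopf_def by blast
  ultimately interpret channel_solution v i \<nu> A B \<delta> u G
    using assms \<delta> by unfold_locales auto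
  have "dev = deviation"
    by (simp add: fun_eq_iff dev deviation_def)
  then show ?thesis
    using deviation_growth[OF t] unfolding \<sigma>(1) \<delta>_def[symmetric] growth_rate_def
    by (simp add: mult.assoc)
qed

text \<open>Testing the weak limit with \<open>1\<^sub>E(t) (U - A e)\<close> for measurable sets \<open>E\<close> of times turns the bound
  for all times, valid along the sequence, into the bound for almost every time.\<close>

lemma layer_separation_bounded_time:
  fixes u :: "real \<Rightarrow> real \<Rightarrow> real^'n \<Rightarrow> real^'n" and i v :: 'n
  assumes iv: "i \<noteq> v" and A: "A > 0" and B: "B > 0" "\<And>x. deriv step x \<le> B"
    and LH: "\<And>\<nu>. \<nu> > 0 \<Longrightarrow> leray_hopf v \<nu> (u \<nu>)"
    and init: "((\<lambda>\<nu>. L2sq cell (\<lambda>x. u \<nu> 0 x - A *\<^sub>R axis i 1)) \<longlongrightarrow> 0) (at_right 0)"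
    and \<nu>s: "\<And>k. 0 < \<nu>s k" "\<nu>s \<longlonglongrightarrow> 0" and T: "T > 0"
    and lim: "L2_weakly_converges ({0<..<T} \<times> cell) (\<lambda>k (t, x). u (\<nu>s k) t x) (\<lambda>(t, x). U t x)"
  shows "AE t in lebesgue_on {0<..<T}.
    L2sq cell (\<lambda>x. U t x - A *\<^sub>R axis i 1) \<le> ennreal (256 * B ^ 3 * exp 2 * A ^ 3 * t)"
proof -
  define \<kappa> where "\<kappa> = 256 * B ^ 3 * exp 2 * A ^ 3"
  have \<kappa>: "\<kappa> > 0" using A B by (simp add: \<kappa>_def)
  define S where "S = {0<..<T} \<times> (cell :: (real^'n) set)"
  have S: "S \<in> lmeasurable"
  proof -
    have "bounded S" by (auto simp: S_def cell_eq_box intro!: bounded_Times)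
    moreover have "open S" by (auto simp: S_def cell_eq_box intro!: open_Times)
    then have "S \<in> sets lebesgue" by auto
    ultimately show ?thesis by (rule bounded_set_imp_lmeasurable)
  qed
  define V where "V t x = U t x - A *\<^sub>R axis i 1" for t x
  define W where "W k t x = u (\<nu>s k) t x - A *\<^sub>R axis i 1" for k t x
  define y where "y t = L2_inner cell (V t) (V t)" for t
  define z where "z k t = L2_inner cell (W k t) (W k t)" for k t
  have c: "in_L2 S (\<lambda>_. A *\<^sub>R axis i 1 :: real^'n)" by (rule in_L2_const[OF S])
  have U: "in_L2 S (\<lambda>(t, x). U t x)" and uk: "in_L2 S (\<lambda>(t, x). u (\<nu>s k) t x)" for k
    using lim by (auto simp: L2_weakly_converges_def S_def)
  have V: "in_L2 S (\<lambda>(t, x). V t x)" and Wk: "in_L2 S (\<lambda>(t, x). W k t x)" for k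
    using in_L2_diff[OF U c] in_L2_diff[OF uk c, of k] by (simp_all add: V_def W_def case_prod_unfold)
  have yi: "integrable (lebesgue_on {0<..<T}) y"
    using integrable_L2_slices[OF V[unfolded S_def]] by (simp add: y_def[abs_def])
  have ivl: "{0<..<T} \<in> sets lebesgue" by simp
  \<comment> \<open>The norm of the limit is only Lebesgue measurable in time; a Borel version makes
    the set of bad times a Borel set.\<close>
  obtain g where g: "g \<in> borel_measurable lborel"
    and g_eq: "AE t in lborel. (if t \<in> {0<..<T} then y t else 0) = g t"
    using completion_ex_borel_measurable_real[OF
        borel_measurable_if_I[OF borel_measurable_integrable[OF yi] ivl]]
    by (elim bexE) (rule that, auto)
  have g_eq': "AE t in lebesgue_on {0<..<T}. y t = g t"
    using g_eq by (simp add: AE_restrict_space_iff AE_completion_iff) (auto elim!: eventually_mono)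
  \<comment> \<open>The times at which the claim fails, up to a null set. The aim is that
    \<open>E\<close> meets the interval in a null set.\<close>
  define E where "E = {t. \<kappa> * t < g t}"
  have E: "E \<in> sets borel"
    unfolding E_def using g by simp
  have E_fst: "(\<lambda>p. indicat_real E (fst p)) \<in> borel_measurable (lebesgue_on S)"
  proof -
    have "(\<lambda>p. indicat_real E (fst p)) \<in> borel_measurable (borel :: (real \<times> (real^'n)) measure)"
      by (rule measurable_compose[OF borel_measurable_continuous_onI])
        (use E in \<open>auto intro!: continuous_intros\<close>)
    then show ?thesis
      by (intro measurable_restrict_space1 measurable_completion) simp
  qed
  have cut: "in_L2 S (\<lambda>(t, x). indicat_real E t *\<^sub>R f t x)" if "in_L2 S (\<lambda>(t, x). f t x)"
    for f :: "real \<Rightarrow> real^'n \<Rightarrow> real^'n"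
    using in_L2_mult_bounded[OF that E_fst, of 1] by (simp add: case_prod_unfold)
  define w where "w = (\<lambda>(t, x). indicat_real E t *\<^sub>R V t x)"
  define wk where "wk k = (\<lambda>(t, x). indicat_real E t *\<^sub>R W k t x)" for k
  have w: "in_L2 S w" and wk: "in_L2 S (wk k)" for k
    unfolding w_def wk_def by (intro cut V Wk)+
  have slices: "L2_inner S (\<lambda>(t, x). indicat_real E t *\<^sub>R f t x) (\<lambda>(t, x). indicat_real E t *\<^sub>R f t x)
      = (\<integral>t. indicat_real E t * L2_inner cell (f t) (f t) \<partial>lebesgue_on {0<..<T})"
    "integrable (lebesgue_on {0<..<T}) (\<lambda>t. indicat_real E t * L2_inner cell (f t) (f t))"
    if "in_L2 S (\<lambda>(t, x). f t x)" for f :: "real \<Rightarrow> real^'n \<Rightarrow> real^'n"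
  proof -
    have *: "L2_inner cell (\<lambda>x. indicat_real E t *\<^sub>R f t x) (\<lambda>x. indicat_real E t *\<^sub>R f t x)
      = indicat_real E t * L2_inner cell (f t) (f t)" for t
      by (simp add: L2_inner_def indicator_def)
    show "L2_inner S (\<lambda>(t, x). indicat_real E t *\<^sub>R f t x) (\<lambda>(t, x). indicat_real E t *\<^sub>R f t x)
      = (\<integral>t. indicat_real E t * L2_inner cell (f t) (f t) \<partial>lebesgue_on {0<..<T})"
      using integral_L2_slices[OF cut[OF that, unfolded S_def]] by (simp add: * S_def)
    show "integrable (lebesgue_on {0<..<T}) (\<lambda>t. indicat_real E t * L2_inner cell (f t) (f t))"
      using integrable_L2_slices[OF cut[OF that, unfolded S_def]] by (simp add: *)
  qed
  have ww: "L2_inner S w w = (\<integral>t. indicat_real E t * y t \<partial>lebesgue_on {0<..<T})"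
    unfolding w_def y_def by (rule slices(1)[OF V])
  \<comment> \<open>Subtracting a fixed field preserves weak convergence. The indicator is
    idempotent, so it may be inserted into the first factor as well.\<close>
  have "(\<lambda>k. L2_inner S (\<lambda>(t, x). u (\<nu>s k) t x) w - L2_inner S (\<lambda>_. A *\<^sub>R axis i 1) w)
      \<longlonglongrightarrow> L2_inner S (\<lambda>(t, x). U t x) w - L2_inner S (\<lambda>_. A *\<^sub>R axis i 1) w"
    using lim w by (intro tendsto_intros) (auto simp: L2_weakly_converges_def S_def)
  moreover have "L2_inner S (\<lambda>(t, x). u (\<nu>s k) t x) w - L2_inner S (\<lambda>_. A *\<^sub>R axis i 1) w
      = L2_inner S (wk k) w" for k
    unfolding L2_inner_diff_left[OF uk c w, symmetric]
    by (auto simp: L2_inner_def wk_def w_def W_def indicator_def intro!: Bochner_Integration.integral_cong)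
  moreover have "L2_inner S (\<lambda>(t, x). U t x) w - L2_inner S (\<lambda>_. A *\<^sub>R axis i 1) w = L2_inner S w w"
    unfolding L2_inner_diff_left[OF U c w, symmetric]
    by (auto simp: L2_inner_def w_def V_def indicator_def intro!: Bochner_Integration.integral_cong)
  ultimately have lim_w: "(\<lambda>k. L2_inner S (wk k) w) \<longlonglongrightarrow> L2_inner S w w"
    by simp
  define \<sigma> where "\<sigma> k = 2 * sqrt (\<nu>s k / (16 * A * B * exp 2))" for k
  have \<sigma>_lim: "\<sigma> \<longlonglongrightarrow> 0"
    unfolding \<sigma>_def[abs_def]
    by (rule tendsto_eq_intros \<nu>s(2) refl | use A B in simp)+
  have z0_lim: "(\<lambda>k. z k 0) \<longlonglongrightarrow> 0"
  proof -
    have "filterlim \<nu>s (at_right 0) sequentially"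
      using \<nu>s by (intro tendsto_imp_filterlim_at_right) auto
    from filterlim_compose[OF init this]
    have "(\<lambda>k. L2sq cell (W k 0)) \<longlonglongrightarrow> 0"
      by (simp add: W_def[abs_def])
    then have "(\<lambda>k. enn2real (L2sq cell (W k 0))) \<longlonglongrightarrow> 0"
      by (intro tendsto_enn2real) auto
    moreover have "in_L2 cell (W k 0)" for k
      using LH[OF \<nu>s(1), of k] unfolding leray_hopf_def energy_class_def W_def[abs_def]
      by (intro in_L2_diff in_L2_const cell_lmeasurable) auto
    ultimately show ?thesis by (simp add: enn2real_L2sq z_def)
  qed
  define I where "I = (\<integral>t. indicat_real E t * t \<partial>lebesgue_on {0<..<T})"
  define J where "J = (\<integral>t. indicat_real E t \<partial>lebesgue_on {0<..<T})"
  have E_on: "indicat_real E \<in> borel_measurable (lebesgue_on {0<..<T})"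
    using E by (intro measurable_restrict_space1 measurable_completion) simp
  have fin: "finite_measure (lebesgue_on {0<..<T})"
    by (intro finite_measure_lebesgue_on bounded_set_imp_lmeasurable) auto
  have Ii: "integrable (lebesgue_on {0<..<T}) (\<lambda>t. indicat_real E t * t)"
  proof (rule finite_measure.integrable_const_bound[OF fin, of _ T])
    show "(\<lambda>t. indicat_real E t * t) \<in> borel_measurable (lebesgue_on {0<..<T})"
      using E_on id_borel_measurable_lebesgue_on[of "{0<..<T}"] by (auto intro!: borel_measurable_times simp: id_def)
  qed (use T in \<open>auto intro!: AE_I2 simp: indicator_def\<close>)
  have Ji: "integrable (lebesgue_on {0<..<T}) (indicat_real E)"
    by (rule finite_measure.integrable_const_bound[OF fin, of _ 1]) (use E_on in \<open>auto intro!: AE_I2\<close>)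
  \<comment> \<open>The bound for every time is integrated over \<open>E\<close>. As the viscosity
    tends to 0, only \<open>\<kappa> * I\<close> survives on the right.\<close>
  have bound: "(1 - \<sigma> k) * L2_inner S (wk k) (wk k)
      \<le> ((1 + \<sigma> k) * z k 0 + 2 * A\<^sup>2 * \<sigma> k) * J + \<kappa> * I" if "\<sigma> k < 1" for k
  proof -
    have "(1 - \<sigma> k) * L2_inner S (wk k) (wk k)
      = (\<integral>t. (1 - \<sigma> k) * (indicat_real E t * z k t) \<partial>lebesgue_on {0<..<T})"
      unfolding wk_def z_def slices(1)[OF Wk] by simp
    also have "\<dots> \<le> (\<integral>t. ((1 + \<sigma> k) * z k 0 + 2 * A\<^sup>2 * \<sigma> k) * indicat_real E t
        + \<kappa> * (indicat_real E t * t) \<partial>lebesgue_on {0<..<T})"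
    proof (rule integral_mono)
      fix t assume "t \<in> space (lebesgue_on {0<..<T})"
      then have "(1 - \<sigma> k) * z k t \<le> (1 + \<sigma> k) * z k 0 + \<kappa> * t + 2 * A\<^sup>2 * \<sigma> k"
        unfolding \<kappa>_def
        by (intro leray_hopf_deviation[OF iv A \<nu>s(1) B LH[OF \<nu>s(1)] \<sigma>_def that])
          (auto simp: z_def W_def[abs_def])
      then show "(1 - \<sigma> k) * (indicat_real E t * z k t)
        \<le> ((1 + \<sigma> k) * z k 0 + 2 * A\<^sup>2 * \<sigma> k) * indicat_real E t + \<kappa> * (indicat_real E t * t)"
        by (auto simp: indicator_def)
    qed (use slices(2)[OF Wk, of k] Ii Ji in
        \<open>auto intro!: integrable_mult_right Bochner_Integration.integrable_add simp: z_def\<close>)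
    also have "\<dots> = ((1 + \<sigma> k) * z k 0 + 2 * A\<^sup>2 * \<sigma> k) * J + \<kappa> * I"
      using Ii Ji unfolding I_def J_def by (subst Bochner_Integration.integral_add) auto
    finally show ?thesis .
  qed
  \<comment> \<open>Weak lower semicontinuity of the norm, from 2 <wk, w> \<le> <wk, wk> + <w, w>.
    The factor 1 - \<sigma> is carried along so that the bound applies before the limit is
    taken.\<close>
  have "2 * L2_inner S w w \<le> \<kappa> * I + L2_inner S w w"
  proof (rule LIMSEQ_le)
    show "(\<lambda>k. (1 - \<sigma> k) * (2 * L2_inner S (wk k) w)) \<longlonglongrightarrow> 2 * L2_inner S w w"
      by (rule tendsto_eq_intros \<sigma>_lim lim_w refl | simp)+
    show "(\<lambda>k. ((1 + \<sigma> k) * z k 0 + 2 * A\<^sup>2 * \<sigma> k) * J + \<kappa> * I + (1 - \<sigma> k) * L2_inner S w w)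
        \<longlonglongrightarrow> \<kappa> * I + L2_inner S w w"
      by (rule tendsto_eq_intros \<sigma>_lim z0_lim refl | simp)+
    have "\<forall>\<^sub>F k in sequentially. \<sigma> k < 1"
      using \<sigma>_lim by (rule order_tendstoD) simp
    then have "\<forall>\<^sub>F k in sequentially. (1 - \<sigma> k) * (2 * L2_inner S (wk k) w)
        \<le> ((1 + \<sigma> k) * z k 0 + 2 * A\<^sup>2 * \<sigma> k) * J + \<kappa> * I + (1 - \<sigma> k) * L2_inner S w w"
    proof eventually_elim
      case (elim k)
      have "(1 - \<sigma> k) * (2 * L2_inner S (wk k) w)
          \<le> (1 - \<sigma> k) * (L2_inner S (wk k) (wk k) + L2_inner S w w)"
        using L2_inner_le[OF wk w, of k] elim by (intro mult_left_mono) auto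
      then show ?case using bound[OF elim] by (simp add: distrib_left)
    qed
    then show "\<exists>N. \<forall>k\<ge>N. (1 - \<sigma> k) * (2 * L2_inner S (wk k) w)
        \<le> ((1 + \<sigma> k) * z k 0 + 2 * A\<^sup>2 * \<sigma> k) * J + \<kappa> * I + (1 - \<sigma> k) * L2_inner S w w"
      by (simp add: eventually_sequentially)
  qed
  then have "(\<integral>t. indicat_real E t * y t \<partial>lebesgue_on {0<..<T}) \<le> \<kappa> * I"
    unfolding ww by simp
  moreover have yEi: "integrable (lebesgue_on {0<..<T}) (\<lambda>t. indicat_real E t * y t)"
    unfolding y_def by (rule slices(2)[OF V])
  ultimately have le: "(\<integral>t. indicat_real E t * y t - \<kappa> * (indicat_real E t * t) \<partial>lebesgue_on {0<..<T}) \<le> 0"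
    using Ii by (simp add: I_def)
  have int: "integrable (lebesgue_on {0<..<T}) (\<lambda>t. indicat_real E t * y t - \<kappa> * (indicat_real E t * t))"
    using yEi Ii by simp
  \<comment> \<open>On \<open>E\<close> the integrand is positive by definition, yet its integral is
    at most 0. Hence it vanishes almost everywhere, and the strict inequality defining
    \<open>E\<close> excludes almost every time.\<close>
  have nn: "AE t in lebesgue_on {0<..<T}. 0 \<le> indicat_real E t * y t - \<kappa> * (indicat_real E t * t)"
    using g_eq' by eventually_elim (auto simp: E_def indicator_def)
  have "(\<integral>t. indicat_real E t * y t - \<kappa> * (indicat_real E t * t) \<partial>lebesgue_on {0<..<T}) = 0"
    using le integral_nonneg_AE[OF nn] by linarith
  then have "AE t in lebesgue_on {0<..<T}. indicat_real E t * y t - \<kappa> * (indicat_real E t * t) = 0"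
    using integral_nonneg_eq_0_iff_AE[OF int nn] by simp
  with g_eq' AE_integrable_L2_slices[OF V[unfolded S_def]]
  show ?thesis
  proof eventually_elim
    case (elim t)
    have "t \<notin> E"
      using elim(1,3) by (auto simp: E_def indicator_def)
    then have "y t \<le> \<kappa> * t" using elim(1) by (simp add: E_def)
    moreover have "L2sq cell (V t) = ennreal (y t)"
      unfolding y_def L2_inner_def L2sq_def
      using elim(2) by (subst nn_integral_eq_integral[symmetric]) (auto simp: power2_norm_eq_inner)
    ultimately show ?case
      by (simp add: V_def[abs_def] \<kappa>_def ennreal_leI)
  qed
qed

lemma layer_separation:
  fixes u :: "real \<Rightarrow> real \<Rightarrow> real^'n \<Rightarrow> real^'n" and i v :: 'n
  assumes iv: "i \<noteq> v" and A: "A > 0" and B: "B > 0" "\<And>x. deriv step x \<le> B"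
    and LH: "\<And>\<nu>. \<nu> > 0 \<Longrightarrow> leray_hopf v \<nu> (u \<nu>)"
    and init: "((\<lambda>\<nu>. L2sq cell (\<lambda>x. u \<nu> 0 x - A *\<^sub>R axis i 1)) \<longlongrightarrow> 0) (at_right 0)"
    and lim: "inviscid_weak_limit u U"
  shows "AE t in lebesgue. 0 < t \<longrightarrow>
    L2sq cell (\<lambda>x. U t x - A *\<^sub>R axis i 1) \<le> ennreal (256 * B ^ 3 * exp 2 * A ^ 3 * t)"
proof -
  obtain \<nu>s where \<nu>s: "\<And>k::nat. 0 < \<nu>s k" "\<nu>s \<longlonglongrightarrow> 0"
    and lim: "\<And>T. T > 0 \<Longrightarrow>
      L2_weakly_converges ({0<..<T} \<times> cell) (\<lambda>k (t, x). u (\<nu>s k) t x) (\<lambda>(t, x). U t x)"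
    using lim unfolding inviscid_weak_limit_def by blast
  \<comment> \<open>The null set may depend on the time horizon, so the half-line is exhausted by
    countably many intervals.\<close>
  have "AE t in lebesgue. t \<in> {0<..<real (Suc n)} \<longrightarrow>
      L2sq cell (\<lambda>x. U t x - A *\<^sub>R axis i 1) \<le> ennreal (256 * B ^ 3 * exp 2 * A ^ 3 * t)" for n
    using layer_separation_bounded_time[OF iv A B LH init \<nu>s _ lim, of "real (Suc n)"]
    by (simp add: AE_restrict_space_iff)
  then have "AE t in lebesgue. \<forall>n. t \<in> {0<..<real (Suc n)} \<longrightarrow>
      L2sq cell (\<lambda>x. U t x - A *\<^sub>R axis i 1) \<le> ennreal (256 * B ^ 3 * exp 2 * A ^ 3 * t)"
    by (subst AE_all_countable) (rule allI)
  then show ?thesis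
  proof eventually_elim
    case (elim t)
    obtain n where "t < real n" using reals_Archimedean2 by blast
    then have "t < real (Suc n)" by simp
    with elim show ?case by auto
  qed
qed

theorem corollary1p3:
  shows "\<exists>C::real. C > 0 \<and>
    (\<forall>A>0. \<forall>(u :: real \<Rightarrow> real \<Rightarrow> real^2 \<Rightarrow> real^2) U.
       (\<forall>\<nu>>0. leray_hopf 2 \<nu> (u \<nu>)) \<and>
       ((\<lambda>\<nu>. L2sq cell (\<lambda>x. u \<nu> 0 x - A *\<^sub>R axis 1 1)) \<longlongrightarrow> 0) (at_right 0) \<and>
       inviscid_weak_limit u U \<longrightarrow>
       (AE T in lebesgue. T > 0 \<longrightarrow>
          L2sq cell (\<lambda>x. U T x - A *\<^sub>R axis 1 1) \<le> ennreal (C * A ^ 3 * T))) \<and>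
    (\<forall>A>0. \<forall>(u :: real \<Rightarrow> real \<Rightarrow> real^3 \<Rightarrow> real^3) U.
       (\<forall>\<nu>>0. leray_hopf 3 \<nu> (u \<nu>)) \<and>
       ((\<lambda>\<nu>. L2sq cell (\<lambda>x. u \<nu> 0 x - A *\<^sub>R axis 1 1)) \<longlongrightarrow> 0) (at_right 0) \<and>
       inviscid_weak_limit u U \<longrightarrow>
       (AE T in lebesgue. T > 0 \<longrightarrow>
          L2sq cell (\<lambda>x. U T x - A *\<^sub>R axis 1 1) \<le> ennreal (C * A ^ 3 * T)))"
proof -
  obtain B where B: "B > 0" "\<And>x. deriv step x \<le> B"
    using step_deriv_bounded by blast
  \<comment> \<open>In the index types the numerals 2 and 3 denote the residue 0, so the vertical
    index differs from 1. One lemma then covers both dimensions, with a constant that depends on the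
    step profile alone.\<close>
  have "(1::2) \<noteq> 2" "(1::3) \<noteq> 3" by simp_all
  then show ?thesis
    using B by (intro exI[of _ "256 * B ^ 3 * exp 2"] conjI allI impI layer_separation) auto
qed

end
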